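(* Fix a constant $t\ge1$. There is a polynomial $p$ such that for all $n,s\ge1$, with $N=2^n$, there exists a $p(\log s,n)$-$\Sigma\Pi\Sigma$-succinct generator for the class of polynomials in $\mathbb{F}[X_1,\ldots,X_N]$ computed by $\Sigma\mathord{\wedge}\Sigma\Pi^{[t]}$ formulas of top fan-in $s$.
   Context: A polynomial $F\in\mathbb{F}[X_1,\ldots,X_N]$ is computed by a $\Sigma\mathord{\wedge}\Sigma\Pi^{[t]}$ formula of top fan-in $s$ if $F=\sum_{i=1}^s X^{a_i}F_i(X)^{d_i}$ where each $X^{a_i}$ is a monomial, each $d_i\ge0$, and $\deg F_i\le t$. Variables $X_1,\ldots,X_N$ are identified with subsets $S\subseteq[n]$ (multilinear monomials $x_S=\prod_{k\in S}x_k$) via $i-1=\sum_{k\in S}2^{k-1}$. A polynomial map $\mathcal{G}:\mathbb{F}^m\to\mathbb{F}^{2^n}$ is an $s'$-$\Sigma\Pi\Sigma$-succinct generator for a class $\mathcal{D}$ of $N$-variate polynomials if (i) for every $\alpha\in\mathbb{F}^m$ the multilinear polynomial $\sum_S\mathcal{G}_S(\alpha)x_S$ is computed by a multilinear depth-3 $\Sigma\Pi\Sigma$ formula of size at most $s'$, and (ii) for every $F\in\mathcal{D}$, $F\not\equiv0$ iff $F\circ\mathcal{G}\not\equiv0$ as a polynomial in the seed variables. *)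

theory Defs
  imports "HOL-Library.Poly_Mapping" "HOL-Computational_Algebra.Polynomial"
begin

text \<open>Multivariate polynomials over 'a in variables indexed by nat
  (variable j stands for X_(j+1)), as finitely supported maps from
  monomials (exponent vectors) to coefficients.\<close>
type_synonym 'a mpoly = "(nat \<Rightarrow>\<^sub>0 nat) \<Rightarrow>\<^sub>0 'a"

definition mconst :: "'a::zero \<Rightarrow> 'a mpoly" where
  "mconst c = Poly_Mapping.single 0 c"

definition mvar :: "nat \<Rightarrow> 'a::{zero,one} mpoly" where
  "mvar j = Poly_Mapping.single (Poly_Mapping.single j 1) 1"

definition mmonom :: "(nat \<Rightarrow>\<^sub>0 nat) \<Rightarrow> 'a::{zero,one} mpoly" where
  "mmonom a = Poly_Mapping.single a 1"

definition mvars :: "'a::zero mpoly \<Rightarrow> nat set" where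
  "mvars p = (\<Union>m\<in>Poly_Mapping.keys p. Poly_Mapping.keys (m :: nat \<Rightarrow>\<^sub>0 nat))"

definition tdeg :: "'a::zero mpoly \<Rightarrow> nat" where
  "tdeg p = Max (insert 0 ((\<lambda>m. \<Sum>j\<in>Poly_Mapping.keys m. Poly_Mapping.lookup m j) ` Poly_Mapping.keys p))"

definition meval :: "'a::comm_semiring_1 mpoly \<Rightarrow> (nat \<Rightarrow> 'a) \<Rightarrow> 'a" where
  "meval p \<alpha> = (\<Sum>m\<in>Poly_Mapping.keys p. Poly_Mapping.lookup p m * (\<Prod>j\<in>Poly_Mapping.keys m. \<alpha> j ^ Poly_Mapping.lookup m j))"

definition msubst :: "'a::comm_semiring_1 mpoly \<Rightarrow> (nat \<Rightarrow> 'a mpoly) \<Rightarrow> 'a mpoly" where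
  "msubst F G = (\<Sum>m\<in>Poly_Mapping.keys F. mconst (Poly_Mapping.lookup F m) * (\<Prod>j\<in>Poly_Mapping.keys m. G j ^ Poly_Mapping.lookup m j))"

definition sws_formula :: "nat \<Rightarrow> nat \<Rightarrow> nat \<Rightarrow> 'a::comm_semiring_1 mpoly \<Rightarrow> bool" where
  "sws_formula N t s F \<longleftrightarrow>
     (\<exists>(a :: nat \<Rightarrow> (nat \<Rightarrow>\<^sub>0 nat)) (d :: nat \<Rightarrow> nat) (Fs :: nat \<Rightarrow> 'a mpoly).
        (\<forall>i<s. Poly_Mapping.keys (a i) \<subseteq> {..<N} \<and> mvars (Fs i) \<subseteq> {..<N} \<and> tdeg (Fs i) \<le> t) \<and>
        F = (\<Sum>i<s. mmonom (a i) * Fs i ^ d i))"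

text \<open>A linear form c + sum_k coeff k * x_k over variables x_0..x_(n-1),
  represented as (c, coeff); its support is {k<n. coeff k \<noteq> 0}.\<close>
type_synonym 'a linform = "'a \<times> (nat \<Rightarrow> 'a)"

definition lf_support :: "nat \<Rightarrow> 'a::zero linform \<Rightarrow> nat set" where
  "lf_support n l = {k. k < n \<and> snd l k \<noteq> 0}"

definition lf_poly :: "nat \<Rightarrow> 'a::comm_semiring_1 linform \<Rightarrow> 'a mpoly" where
  "lf_poly n l = mconst (fst l) + (\<Sum>k<n. mconst (snd l k) * mvar k)"

text \<open>A depth-3 Sigma-Pi-Sigma formula over x_0..x_(n-1): a list of product
  gates, each a list of linear forms.  It is multilinear if within every
  product gate the linear forms have pairwise disjoint supports.\<close>
definition sps_multilinear :: "nat \<Rightarrow> 'a::zero linform list list \<Rightarrow> bool" where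
  "sps_multilinear n C \<longleftrightarrow>
     (\<forall>P\<in>set C. \<forall>i<length P. \<forall>j<length P. i \<noteq> j \<longrightarrow>
        lf_support n (P ! i) \<inter> lf_support n (P ! j) = {})"

definition sps_poly :: "nat \<Rightarrow> 'a::comm_semiring_1 linform list list \<Rightarrow> 'a mpoly" where
  "sps_poly n C = (\<Sum>P\<leftarrow>C. \<Prod>l\<leftarrow>P. lf_poly n l)"

text \<open>Formula size = number of nodes: the top sum gate, each product gate,
  each linear-form sum gate with its constant leaf and one leaf per variable
  in its support.\<close>
definition sps_size :: "nat \<Rightarrow> 'a::zero linform list list \<Rightarrow> nat" where
  "sps_size n C = 1 + (\<Sum>P\<leftarrow>C. 1 + (\<Sum>l\<leftarrow>P. 2 + card (lf_support n l)))"

text \<open>Subsets S of {0..n-1} (variable k stands for x_(k+1)) are coded by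
  sum_{k in S} 2^k, i.e. i-1 in the paper's 1-based indexing.\<close>
definition set_code :: "nat set \<Rightarrow> nat" where
  "set_code S = (\<Sum>k\<in>S. 2 ^ k)"

definition mono_x :: "nat set \<Rightarrow> 'a::comm_semiring_1 mpoly" where
  "mono_x S = (\<Prod>k\<in>S. mvar k)"

text \<open>G : F^m \<rightarrow> F^(2^n) given by component polynomials G j (j < 2^n) in seed
  variables 0..m-1 is an s'-Sigma-Pi-Sigma-succinct generator for the class D
  of polynomials in variables 0..2^n-1.\<close>
definition succinct_generator ::
  "nat \<Rightarrow> nat \<Rightarrow> nat \<Rightarrow> (nat \<Rightarrow> 'a::field mpoly) \<Rightarrow> ('a mpoly \<Rightarrow> bool) \<Rightarrow> bool" where
  "succinct_generator n m s' G D \<longleftrightarrow>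
     (\<forall>j<2^n. mvars (G j) \<subseteq> {..<m}) \<and>
     (\<forall>\<alpha> :: nat \<Rightarrow> 'a. \<exists>C. sps_multilinear n C \<and> sps_size n C \<le> s' \<and>
        sps_poly n C = (\<Sum>S\<in>Pow {..<n}. mconst (meval (G (set_code S)) \<alpha>) * mono_x S)) \<and>
     (\<forall>F. D F \<longrightarrow> (F \<noteq> 0 \<longleftrightarrow> msubst F G \<noteq> 0))"

end

(* A sum of k generic rank-one tensors added to the all-ones vector is computed by k + 1 product
   gates.  A nonzero F is hit by it once F(1 + x) has a nonzero monomial with at most k variables,
   because each summand can be degenerated to a multiple of one coordinate vector.

   In characteristic 0, restrict F(1 + x) to a minimal set T of variables on which it does not
   vanish.  All its monomials then have support exactly T, so the operators (1 + x_v) d/dx_v followed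
   by shifts produce many distinct trailing monomials, whereas they map X^a f^d into X^a f^(d - r)
   times polynomials of low degree.  Comparing dimensions forces |T| = O(2^t log s).

   In characteristic p this fails: x_1 x_2^q x_3^(q^2) ... is a sum of few powers of linear forms over
   a large field.  Instead write F as the sum of x^b F_b(x^p) over exponent vectors b < p.  Base-p
   expansion of the exponents d shows that few b occur, at this stage and at all later ones.  The
   generator G satisfies G(y)^p = G(y^p), so F(G) is the sum of G(y)^b (F_b(G))(y^p).  Taking a
   monomial of minimal size in the F_b(G) as the p-divisible part of the exponent isolates a sparse
   polynomial in G whose degree in each variable is less than p.  Sparsity bounds the supports here,
   so by induction on the degree F(G) does not vanish. *)

theory Submission
  imports Defs "HOL-Computational_Algebra.Primes" "HOL-Library.Nat_Bijection"
begin

section \<open>Multivariate polynomials\<close>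

text \<open>The obstacle is that neither the monomials X^a nor the exponents d have bounded degree,
  so no count may depend on them. Translation by the all-ones point deals with X^a: it becomes a
  product of powers of the 1 + x_v or 1, a common eigenvector of all operators (1 + x_v) d/dx_v. A
  plain partial derivative would not preserve such a factor. The exponents d drop out because k
  operators cost k powers of f and leave a cofactor of degree at most k t.

  The lower bound needs the exponents of a trailing monomial to be nonzero in the field. In
  characteristic 0 the minimality of T is enough, and it makes every k-subset of T usable. In
  characteristic p the exponents must also lie below p, which is why the argument there is applied
  only to a polynomial with residues modulo p as exponents.

  The number of residue vectors b is at most s (2^n + 1)^(p t). Its logarithm is linear in log s and
  n; here n enters the number of summands of the generator. The constants depend on t and on the
  characteristic, which is legitimate because the field is fixed before the bounding
  polynomial.\<close>

lemma lookup_mconst_mult: "Poly_Mapping.lookup (mconst c * p) m = c * Poly_Mapping.lookup p m"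
  for p :: "'a::comm_semiring_1 mpoly"
  unfolding mconst_def mult_map_scale_conv_mult[symmetric]
  by (simp add: Poly_Mapping.map.rep_eq when_def)

lemma mconst_0 [simp]: "mconst 0 = 0"
  by (simp add: mconst_def)

lemma mconst_1 [simp]: "mconst 1 = 1"
  by (simp add: mconst_def)

lemma mconst_add: "mconst (a + b) = mconst a + mconst b"
  by (simp add: mconst_def single_add)

lemma mconst_mult: "mconst (a * b) = mconst a * mconst b" for a :: "'a::comm_semiring_1"
  by (simp add: mconst_def mult_single)

lemma mconst_sum: "mconst (sum f A) = (\<Sum>x\<in>A. mconst (f x))"
  by (induction A rule: infinite_finite_induct) (auto simp: mconst_add)

lemma mconst_prod: "mconst (prod f A) = (\<Prod>x\<in>A. mconst (f x))" for f :: "_ \<Rightarrow> 'a::comm_semiring_1"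
  by (induction A rule: infinite_finite_induct) (auto simp: mconst_mult)

lemma mconst_power: "mconst (a ^ n) = mconst a ^ n" for a :: "'a::comm_semiring_1"
  by (induction n) (auto simp: mconst_mult)

lemma of_nat_mpoly: "of_nat n = (mconst (of_nat n) :: 'a::comm_semiring_1 mpoly)"
  by (induction n) (auto simp: mconst_add)

lemma mmonom_0 [simp]: "mmonom 0 = 1"
  by (simp add: mmonom_def)

lemma mmonom_add: "mmonom (a + b) = mmonom a * (mmonom b :: 'a::comm_semiring_1 mpoly)"
  by (simp add: mmonom_def mult_single)

lemma mmonom_sum: "mmonom (sum f A) = (\<Prod>x\<in>A. (mmonom (f x) :: 'a::comm_semiring_1 mpoly))"
  by (induction A rule: infinite_finite_induct) (auto simp: mmonom_add)

lemma mvar_eq_mmonom: "mvar j = mmonom (Poly_Mapping.single j 1)"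
  by (simp add: mvar_def mmonom_def)


lemma lookup_mmonom: "Poly_Mapping.lookup (mmonom a) m = (if m = a then 1 else 0)"
  by (simp add: mmonom_def lookup_single when_def)

lemma keys_mmonom [simp]: "Poly_Mapping.keys (mmonom a :: 'a::comm_semiring_1 mpoly) = {a}"
  by (simp add: mmonom_def)

lemma mpoly_expand_superset:
  fixes p :: "'a::comm_semiring_1 mpoly"
  assumes "finite M" "Poly_Mapping.keys p \<subseteq> M"
  shows "p = (\<Sum>m\<in>M. mconst (Poly_Mapping.lookup p m) * mmonom m)"
proof (rule poly_mapping_eqI)
  fix k
  have "(\<Sum>m\<in>M. Poly_Mapping.lookup p m * (if k = m then 1 else 0)) = Poly_Mapping.lookup p k"
    using assms by (auto simp: if_distrib[of "\<lambda>x. _ * x"] sum.delta' in_keys_iff subset_iff cong: if_cong)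
  then show "Poly_Mapping.lookup p k = Poly_Mapping.lookup (\<Sum>m\<in>M. mconst (Poly_Mapping.lookup p m) * mmonom m) k"
    by (simp add: lookup_sum lookup_mconst_mult lookup_mmonom)
qed

lemmas mpoly_expand = mpoly_expand_superset[OF finite_keys subset_refl]


lemma keys_sumE:
  assumes "m \<in> Poly_Mapping.keys (sum f I)"
  obtains i where "i \<in> I" "m \<in> Poly_Mapping.keys (f i)"
proof (rule ccontr)
  assume "\<not> thesis"
  then have "\<forall>i\<in>I. Poly_Mapping.lookup (f i) m = 0" using that by (auto simp: in_keys_iff)
  then show False using assms by (simp add: in_keys_iff lookup_sum)
qed

lemma keys_multE:
  assumes "m \<in> Poly_Mapping.keys (p * q)"
  obtains a b where "m = a + b" "a \<in> Poly_Mapping.keys p" "b \<in> Poly_Mapping.keys q"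
  using keys_mult[of p q] assms by blast

lemma keys_mconst_mult_subset:
  "Poly_Mapping.keys (mconst c * p) \<subseteq> Poly_Mapping.keys (p :: 'a::comm_semiring_1 mpoly)"
  by (auto simp: in_keys_iff lookup_mconst_mult)

lemma lookup_mmonom_mult_add:
  "Poly_Mapping.lookup (mmonom e * p) (e + m) = Poly_Mapping.lookup p m" for p :: "'a::comm_semiring_1 mpoly"
proof -
  have "mmonom e * p = (\<Sum>k\<in>Poly_Mapping.keys p. mconst (Poly_Mapping.lookup p k) * mmonom (e + k))"
    by (subst mpoly_expand[of p]) (simp add: sum_distrib_left mmonom_add mult_ac)
  also have "Poly_Mapping.lookup \<dots> (e + m)
      = (\<Sum>k\<in>Poly_Mapping.keys p. if m = k then Poly_Mapping.lookup p k else 0)"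
    unfolding lookup_sum lookup_mconst_mult lookup_mmonom by (intro sum.cong) auto
  also have "\<dots> = Poly_Mapping.lookup p m"
    by (auto simp: sum.delta' in_keys_iff)
  finally show ?thesis .
qed

lemma lookup_mmonom_mult_eq_0:
  fixes p :: "'a::comm_semiring_1 mpoly"
  assumes "\<And>m'. m \<noteq> e + m'"
  shows "Poly_Mapping.lookup (mmonom e * p) m = 0"
proof (rule ccontr)
  assume "\<not> ?thesis"
  then have "m \<in> Poly_Mapping.keys (mmonom e * p)" by (simp add: in_keys_iff)
  then obtain b where "m = e + b" by (auto elim!: keys_multE)
  then show False using assms by blast
qed

section \<open>Linear extension and substitution\<close>

text \<open>Substitution and the differential operator \<open>euler_op\<close> are both linear
  extensions of a map on monomials, multiplicative in one case and a derivation in the other.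
  Linearity is thus proved once for both.\<close>

definition lin_ext :: "((nat \<Rightarrow>\<^sub>0 nat) \<Rightarrow> 'a mpoly) \<Rightarrow> 'a mpoly \<Rightarrow> 'a::comm_semiring_1 mpoly" where
  "lin_ext f p = (\<Sum>m\<in>Poly_Mapping.keys p. mconst (Poly_Mapping.lookup p m) * f m)"

lemma lin_ext_superset:
  assumes "finite M" "Poly_Mapping.keys p \<subseteq> M"
  shows "lin_ext f p = (\<Sum>m\<in>M. mconst (Poly_Mapping.lookup p m) * f m)"
  unfolding lin_ext_def using assms by (intro sum.mono_neutral_left) (auto simp: in_keys_iff)

lemma lin_ext_0 [simp]: "lin_ext f 0 = 0"
  by (simp add: lin_ext_def)

lemma lin_ext_add: "lin_ext f (p + q) = lin_ext f p + lin_ext f q"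
proof -
  let ?M = "Poly_Mapping.keys p \<union> Poly_Mapping.keys q"
  have "Poly_Mapping.keys (p + q) \<subseteq> ?M" by (rule keys_add)
  then show ?thesis
    by (simp add: lin_ext_superset[of ?M] lookup_add mconst_add distrib_right sum.distrib)
qed

lemma lin_ext_sum: "lin_ext f (sum g A) = (\<Sum>x\<in>A. lin_ext f (g x))"
  by (induction A rule: infinite_finite_induct) (auto simp: lin_ext_add)

lemma lin_ext_mconst_mult: "lin_ext f (mconst c * p) = mconst c * lin_ext f p"
  unfolding lin_ext_superset[OF finite_keys keys_mconst_mult_subset]
  by (simp add: lookup_mconst_mult mconst_mult lin_ext_def sum_distrib_left mult.assoc)

lemma lin_ext_mmonom [simp]: "lin_ext f (mmonom m) = f m"
  by (simp add: lin_ext_def lookup_mmonom)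

lemma mult_expand:
  fixes p q :: "'a::comm_semiring_1 mpoly"
  shows "p * q = (\<Sum>a\<in>Poly_Mapping.keys p. \<Sum>b\<in>Poly_Mapping.keys q.
      mconst (Poly_Mapping.lookup p a) * (mconst (Poly_Mapping.lookup q b) * mmonom (a + b)))"
  by (subst mpoly_expand[of p], subst mpoly_expand[of q])
     (simp add: sum_product mmonom_add mult_ac)

lemma lin_ext_mult:
  assumes "\<And>a b. f (a + b) = f a * f b"
  shows "lin_ext f (p * q) = lin_ext f p * lin_ext f q"
proof -
  have "lin_ext f (p * q) = (\<Sum>a\<in>Poly_Mapping.keys p. \<Sum>b\<in>Poly_Mapping.keys q.
      mconst (Poly_Mapping.lookup p a) * (mconst (Poly_Mapping.lookup q b) * (f a * f b)))"
    by (subst mult_expand) (simp add: lin_ext_sum lin_ext_mconst_mult assms)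
  also have "\<dots> = lin_ext f p * lin_ext f q"
    by (simp add: lin_ext_def sum_product mult_ac)
  finally show ?thesis .
qed

definition mpow :: "(nat \<Rightarrow> 'a mpoly) \<Rightarrow> (nat \<Rightarrow>\<^sub>0 nat) \<Rightarrow> 'a::comm_semiring_1 mpoly" where
  "mpow G m = (\<Prod>j\<in>Poly_Mapping.keys m. G j ^ Poly_Mapping.lookup m j)"

lemma mpow_superset:
  assumes "finite M" "Poly_Mapping.keys m \<subseteq> M"
  shows "mpow G m = (\<Prod>j\<in>M. G j ^ Poly_Mapping.lookup m j)"
  unfolding mpow_def using assms by (intro prod.mono_neutral_left) (auto simp: in_keys_iff)

lemma mpow_0 [simp]: "mpow G 0 = 1"
  by (simp add: mpow_def)

lemma mpow_add: "mpow G (a + b) = mpow G a * mpow G b"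
proof -
  let ?M = "Poly_Mapping.keys a \<union> Poly_Mapping.keys b"
  have "Poly_Mapping.keys (a + b) \<subseteq> ?M" by (rule keys_add)
  then show ?thesis
    by (simp add: mpow_superset[of ?M] lookup_add power_add prod.distrib)
qed

lemma mpow_single: "mpow G (Poly_Mapping.single j e) = G j ^ e"
  by (cases "e = 0") (auto simp: mpow_def)

lemma mpow_mvar: "mpow mvar m = (mmonom m :: 'a::comm_semiring_1 mpoly)"
proof -
  have p: "mmonom (Poly_Mapping.single j e) = (mvar j ^ e :: 'a mpoly)" for j e
  proof (induction e)
    case (Suc e)
    have "Poly_Mapping.single j (Suc e) = Poly_Mapping.single j 1 + Poly_Mapping.single j e"
      by (simp flip: single_add)
    then show ?case by (simp add: mmonom_add Suc mvar_eq_mmonom)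
  qed simp
  have "m = (\<Sum>j\<in>Poly_Mapping.keys m. Poly_Mapping.single j (Poly_Mapping.lookup m j))"
    by (rule poly_mapping_eqI) (auto simp: lookup_sum lookup_single when_def sum.delta' in_keys_iff)
  then have "mmonom m = (\<Prod>j\<in>Poly_Mapping.keys m. mmonom (Poly_Mapping.single j (Poly_Mapping.lookup m j)) :: 'a mpoly)"
    by (metis mmonom_sum)
  then show ?thesis by (simp add: mpow_def p)
qed

lemma msubst_lin_ext: "msubst F G = lin_ext (mpow G) F"
  by (simp add: msubst_def lin_ext_def mpow_def)

lemma msubst_0 [simp]: "msubst 0 G = 0"
  by (simp add: msubst_lin_ext)

lemma msubst_add: "msubst (p + q) G = msubst p G + msubst q G"
  by (simp add: msubst_lin_ext lin_ext_add)

lemma msubst_sum: "msubst (sum f A) G = (\<Sum>x\<in>A. msubst (f x) G)"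
  by (simp add: msubst_lin_ext lin_ext_sum)

lemma msubst_mmonom: "msubst (mmonom m) G = mpow G m"
  by (simp add: msubst_lin_ext)

lemma msubst_mconst_mult: "msubst (mconst c * p) G = mconst c * msubst p G"
  by (simp add: msubst_lin_ext lin_ext_mconst_mult)

lemma msubst_1 [simp]: "msubst 1 G = 1"
  using msubst_mmonom[of 0 G] by simp

lemma msubst_mconst [simp]: "msubst (mconst c) G = mconst c"
  using msubst_mconst_mult[of c 1 G] by simp

lemma msubst_mvar [simp]: "msubst (mvar j) G = G j"
  by (simp add: mvar_eq_mmonom msubst_mmonom mpow_single)

lemma msubst_mult: "msubst (p * q) G = msubst p G * msubst q G"
  by (simp add: msubst_lin_ext lin_ext_mult mpow_add)

lemma msubst_power: "msubst (p ^ n) G = msubst p G ^ n"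
  by (induction n) (auto simp: msubst_mult)

lemma msubst_prod: "msubst (prod f A) G = (\<Prod>x\<in>A. msubst (f x) G)"
  by (induction A rule: infinite_finite_induct) (auto simp: msubst_mult)

lemma msubst_mpow: "msubst (mpow G m) H = mpow (\<lambda>j. msubst (G j) H) m"
  by (simp add: mpow_def msubst_prod msubst_power)

lemma msubst_msubst: "msubst (msubst F G) H = msubst F (\<lambda>j. msubst (G j) H)"
  by (simp add: msubst_lin_ext[of F] lin_ext_def msubst_sum msubst_mconst_mult msubst_mpow)

lemma msubst_ident [simp]: "msubst F mvar = F"
  using mpoly_expand[of F] by (simp add: msubst_lin_ext lin_ext_def mpow_mvar)

lemma msubst_cong:
  assumes "\<And>j. j \<in> mvars F \<Longrightarrow> G j = H j"
  shows "msubst F G = msubst F H"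
proof -
  have "mpow G m = mpow H m" if "m \<in> Poly_Mapping.keys F" for m
    unfolding mpow_def using assms that by (intro prod.cong refl) (force simp: mvars_def)
  then show ?thesis by (simp add: msubst_lin_ext lin_ext_def)
qed

lemma mconst_meval: "mconst (meval p \<alpha>) = msubst p (\<lambda>j. mconst (\<alpha> j))"
  by (simp add: meval_def msubst_def mconst_sum mconst_mult mconst_prod mconst_power)

section \<open>The generator\<close>

text \<open>This substitution only deletes monomials and never merges them. Hence whatever survives
  it was already present before, which makes it safe for degenerating the generator and for
  shrinking T.\<close>

definition keep :: "nat set \<Rightarrow> nat \<Rightarrow> 'a::comm_semiring_1 mpoly" where
  "keep J j = (if j \<in> J then mvar j else 0)"

lemma mpow_keep: "mpow (keep J) m = (if Poly_Mapping.keys m \<subseteq> J then mmonom m else 0)"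
proof (cases "Poly_Mapping.keys m \<subseteq> J")
  case True
  then have "mpow (keep J) m = (mpow mvar m :: 'a mpoly)"
    unfolding mpow_def by (intro prod.cong refl) (auto simp: keep_def)
  with True show ?thesis by (simp add: mpow_mvar)
next
  case False
  then obtain j where "j \<in> Poly_Mapping.keys m" "j \<notin> J" by auto
  then have "\<exists>j\<in>Poly_Mapping.keys m. keep J j ^ Poly_Mapping.lookup m j = (0 :: 'a mpoly)"
    by (intro bexI[of _ j]) (auto simp: keep_def in_keys_iff zero_power)
  with False show ?thesis by (simp add: mpow_def prod_zero)
qed

lemma lookup_msubst_keep:
  "Poly_Mapping.lookup (msubst p (keep J)) m =
     (if Poly_Mapping.keys m \<subseteq> J then Poly_Mapping.lookup p m else 0)"
proof -
  have "Poly_Mapping.lookup (msubst p (keep J)) m = (\<Sum>a\<in>Poly_Mapping.keys p.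
      if m = a then (if Poly_Mapping.keys m \<subseteq> J then Poly_Mapping.lookup p m else 0) else 0)"
    unfolding msubst_lin_ext lin_ext_def lookup_sum lookup_mconst_mult mpow_keep
    by (intro sum.cong refl) (auto simp: lookup_mmonom)
  then show ?thesis by (auto simp: sum.delta' in_keys_iff)
qed

definition indicator_exp :: "nat set \<Rightarrow> (nat \<Rightarrow>\<^sub>0 nat)" where
  "indicator_exp A = (\<Sum>a\<in>A. Poly_Mapping.single a 1)"

lemma lookup_indicator_exp: "finite A \<Longrightarrow> Poly_Mapping.lookup (indicator_exp A) x = (if x \<in> A then 1 else 0)"
  by (simp add: indicator_exp_def lookup_sum lookup_single when_def sum.delta)

lemma keys_indicator_exp: "finite A \<Longrightarrow> Poly_Mapping.keys (indicator_exp A) = A"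
  by (auto simp: in_keys_iff lookup_indicator_exp split: if_splits)

lemma mpow_indicator_exp: "finite A \<Longrightarrow> mpow G (indicator_exp A) = (\<Prod>a\<in>A. G a)"
  by (simp add: mpow_def keys_indicator_exp lookup_indicator_exp)

text \<open>Block \<open>i\<close> owns the \<open>2 * n + 1\<close> seeds from index \<open>i * (2 * n + 1)\<close> on: a scalar, followed by
  a pair of seeds \<open>v\<^sub>m, y\<^sub>m\<close> for each \<open>m < n\<close>.  The coordinate of a set picks \<open>y\<^sub>m\<close> for the members
  and \<open>v\<^sub>m\<close> for the non-members.\<close>

definition seed_block :: "nat \<Rightarrow> nat \<Rightarrow> nat \<Rightarrow> nat set" where
  "seed_block n i j = insert (i * (2 * n + 1))
     ((\<lambda>m. i * (2 * n + 1) + 1 + 2 * m + (if m \<in> set_decode j then 1 else 0)) ` {..<n})"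

text \<open>For fixed i, the monomials of block i over all j are the coefficients of z (y_0 x_0 +
  v_0) (y_1 x_1 + v_1) ... as a polynomial in x. The constant 1 is the coefficient of every
  multilinear monomial in the product of the 1 + x_m. All coefficients being 1 is what later lets
  the p-th power act on the seeds alone.\<close>

definition sparse_gen :: "nat \<Rightarrow> nat \<Rightarrow> nat \<Rightarrow> 'a::comm_semiring_1 mpoly" where
  "sparse_gen n k j = 1 + (\<Sum>i<k. mmonom (indicator_exp (seed_block n i j)))"

lemma finite_seed_block [simp]: "finite (seed_block n i j)"
  by (simp add: seed_block_def)

lemma seed_block_div:
  assumes "x \<in> seed_block n i j"
  shows "x div (2 * n + 1) = i"
proof -
  obtain r where "x = i * (2 * n + 1) + r" "r < 2 * n + 1"
    using assms by (fastforce simp: seed_block_def add.assoc split: if_splits)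
  then show ?thesis by (simp only: div_mult_self3 div_less)
qed

lemma set_decode_subset:
  assumes "j < 2 ^ n"
  shows "set_decode j \<subseteq> {..<n}"
proof
  fix m assume "m \<in> set_decode j"
  then have "j div 2 ^ m \<noteq> 0" by (auto simp: set_decode_def intro!: Nat.gr0I)
  then have "2 ^ m \<le> j" by (simp add: div_eq_0_iff)
  with assms have "(2::nat) ^ m < 2 ^ n" by linarith
  then show "m \<in> {..<n}" by simp
qed

text \<open>Each coordinate takes exactly one seed from each of the n pairs, so an inclusion forces
  the same choice in every pair. The blocks of different coordinates therefore form an antichain:
  keeping just the seeds of one coordinate kills the monomials of all the others.\<close>

lemma seed_block_subset_eq:
  assumes "seed_block n i j \<subseteq> seed_block n i j'" "j < 2 ^ n" "j' < 2 ^ n"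
  shows "j = j'"
proof -
  have "m \<in> set_decode j \<longleftrightarrow> m \<in> set_decode j'" if "m < n" for m
  proof -
    let ?x = "i * (2 * n + 1) + 1 + 2 * m + (if m \<in> set_decode j then 1 else 0)"
    have "?x \<in> seed_block n i j'" using assms(1) that by (auto simp: seed_block_def)
    then obtain m' where "?x = i * (2 * n + 1) + 1 + 2 * m' + (if m' \<in> set_decode j' then 1 else 0)"
      by (auto simp: seed_block_def split: if_splits)
    then have *: "2 * m + (if m \<in> set_decode j then 1 else 0) = 2 * m' + (if m' \<in> set_decode j' then 1 else 0)"
      by linarith
    then have "m = m'" by (auto split: if_splits; presburger)
    with * show ?thesis by (auto split: if_splits)
  qed
  then have "set_decode j = set_decode j'"
    using set_decode_subset[OF assms(2)] set_decode_subset[OF assms(3)] by blast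
  then show ?thesis by (metis set_decode_inverse)
qed

section \<open>Variables occurring in a polynomial\<close>

lemma mvars_subset_iff: "mvars p \<subseteq> T \<longleftrightarrow> (\<forall>m\<in>Poly_Mapping.keys p. Poly_Mapping.keys m \<subseteq> T)"
  by (simp add: mvars_def UN_subset_iff)

lemma mvars_mult:
  assumes "mvars p \<subseteq> T" "mvars q \<subseteq> T"
  shows "mvars (p * q) \<subseteq> T"
  unfolding mvars_subset_iff
proof
  fix m assume "m \<in> Poly_Mapping.keys (p * q)"
  then obtain a b where "m = a + b" "a \<in> Poly_Mapping.keys p" "b \<in> Poly_Mapping.keys q"
    by (blast elim: keys_multE)
  with assms keys_add[of a b] show "Poly_Mapping.keys m \<subseteq> T"
    unfolding mvars_subset_iff by blast
qed

lemma mvars_add: "mvars p \<subseteq> T \<Longrightarrow> mvars q \<subseteq> T \<Longrightarrow> mvars (p + q) \<subseteq> T"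
  using keys_add[of p q] unfolding mvars_subset_iff by blast

lemma mvars_mconst [simp]: "mvars (mconst c) = {}"
  by (auto simp: mvars_def mconst_def)

lemma mvars_0 [simp]: "mvars 0 = {}"
  by (auto simp: mvars_def)

lemma mvars_1 [simp]: "mvars 1 = {}"
  by (auto simp: mvars_def)

lemma mvars_mmonom [simp]: "mvars (mmonom m :: 'a::comm_semiring_1 mpoly) = Poly_Mapping.keys m"
  by (auto simp: mvars_def)

lemma mvars_mvar [simp]: "mvars (mvar j :: 'a::comm_semiring_1 mpoly) = {j}"
  by (simp add: mvar_eq_mmonom)

lemma mvars_sum: "(\<And>i. i \<in> A \<Longrightarrow> mvars (f i) \<subseteq> T) \<Longrightarrow> mvars (sum f A) \<subseteq> T"
  by (induction A rule: infinite_finite_induct) (simp_all add: mvars_add)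

lemma mvars_prod: "(\<And>i. i \<in> A \<Longrightarrow> mvars (f i) \<subseteq> T) \<Longrightarrow> mvars (prod f A) \<subseteq> T"
  by (induction A rule: infinite_finite_induct) (simp_all add: mvars_mult)

lemma mvars_power: "mvars p \<subseteq> T \<Longrightarrow> mvars (p ^ e) \<subseteq> T"
  by (induction e) (simp_all add: mvars_mult)

lemma mvars_msubst:
  assumes "\<And>j. j \<in> mvars F \<Longrightarrow> mvars (G j) \<subseteq> T"
  shows "mvars (msubst F G) \<subseteq> T"
  unfolding msubst_def
proof (rule mvars_sum)
  fix m assume "m \<in> Poly_Mapping.keys F"
  then have "mvars (G j) \<subseteq> T" if "j \<in> Poly_Mapping.keys m" for j
    using assms that unfolding mvars_def by blast
  then show "mvars (mconst (Poly_Mapping.lookup F m) * (\<Prod>j\<in>Poly_Mapping.keys m. G j ^ Poly_Mapping.lookup m j)) \<subseteq> T"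
    by (intro mvars_mult mvars_prod mvars_power) simp_all
qed

lemma mvars_sparse_gen: "mvars (sparse_gen n k j :: 'a::comm_semiring_1 mpoly) \<subseteq> {..<k * (2 * n + 1)}"
proof -
  have "seed_block n i j \<subseteq> {..<k * (2 * n + 1)}" if "i < k" for i
  proof
    fix x assume "x \<in> seed_block n i j"
    then have "x div (2 * n + 1) < k" using that seed_block_div by blast
    then show "x \<in> {..<k * (2 * n + 1)}" by (simp add: div_less_iff_less_mult del: mult_Suc_right)
  qed
  then show ?thesis unfolding sparse_gen_def
    by (intro mvars_add mvars_sum) (auto simp: keys_indicator_exp)
qed

text \<open>The restriction of F to the coordinate subspace T through the all-ones point. At that
  point no monomial X^a vanishes, so restricting to fewer variables does not kill it.\<close>

definition shift_sub :: "nat set \<Rightarrow> nat \<Rightarrow> 'a::comm_semiring_1 mpoly" where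
  "shift_sub T v = (if v \<in> T then 1 + mvar v else 1)"

lemma mvars_shift_sub: "mvars (msubst F (shift_sub T)) \<subseteq> T"
  by (intro mvars_msubst) (simp add: shift_sub_def mvars_add)

text \<open>Give each v in T its own block and set to 0 every seed outside the monomials Z_v so
  selected. The generator becomes 1 + Z_v on T and 1 elsewhere. The Z_v use disjoint sets of seeds,
  so they are algebraically independent and F(1 + Z) has no cancellation. Since the Z_v are
  squarefree, the exponents found are exponents of w or 0; in characteristic p this keeps them below
  p.\<close>

lemma sparse_gen_hits:
  fixes F :: "'a::comm_semiring_1 mpoly"
  assumes T: "T \<subseteq> {..<2 ^ n}" "card T \<le> k" and F: "mvars F \<subseteq> {..<2 ^ n}"
    and w: "w \<in> Poly_Mapping.keys (msubst F (shift_sub T))"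
  shows "\<exists>\<nu>\<in>Poly_Mapping.keys (msubst F (sparse_gen n k)).
    \<forall>x. Poly_Mapping.lookup \<nu> x = 0 \<or> (\<exists>v. Poly_Mapping.lookup \<nu> x = Poly_Mapping.lookup w v)"
proof -
  have finT: "finite T" using T(1) finite_subset by blast
  obtain \<iota> where \<iota>: "inj_on \<iota> T" "\<iota> ` T \<subseteq> {..<k}"
    using card_le_inj[OF finT, of "{..<k}"] T(2) by auto
  let ?B = "\<lambda>v. seed_block n (\<iota> v) v"
  define J where "J = (\<Union>v\<in>T. ?B v)"
  have owner: "v = v'" if "x \<in> ?B v" "x \<in> ?B v'" "v \<in> T" "v' \<in> T" for x v v'
    using seed_block_div[OF that(1)] seed_block_div[OF that(2)] \<iota>(1) that(3,4) by (metis inj_onD)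
  have sub_iff: "seed_block n i j \<subseteq> J \<longleftrightarrow> j \<in> T \<and> i = \<iota> j" if j: "j < 2 ^ n" for i j
  proof
    assume sub: "seed_block n i j \<subseteq> J"
    \<comment> \<open>The scalar seed lies in every coordinate of block i, so its owner in J reveals
      the only v to which block i can belong.\<close>
    have "i * (2 * n + 1) \<in> seed_block n i j" by (simp add: seed_block_def)
    with sub obtain v where v: "v \<in> T" "i * (2 * n + 1) \<in> ?B v" unfolding J_def by auto
    from seed_block_div[OF v(2)] have iv: "i = \<iota> v" by (simp only: nonzero_mult_div_cancel_right)
    have "seed_block n i j \<subseteq> ?B v"
    proof
      fix x assume x: "x \<in> seed_block n i j"
      with sub obtain v' where v': "v' \<in> T" "x \<in> ?B v'" unfolding J_def by auto
      have "\<iota> v' = \<iota> v" using seed_block_div[OF x] seed_block_div[OF v'(2)] iv by simp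
      then have "v' = v" using \<iota>(1) v(1) v'(1) by (meson inj_onD)
      with v' show "x \<in> ?B v" by simp
    qed
    with iv seed_block_subset_eq[of n i j v] j v(1) T(1) have "j = v" by auto
    with v(1) iv show "j \<in> T \<and> i = \<iota> j" by simp
  qed (auto simp: J_def)
  define Z :: "nat \<Rightarrow> 'a mpoly" where "Z v = mmonom (indicator_exp (?B v))" for v
  have sparse_gen_keep: "msubst (sparse_gen n k j) (keep J) = (if j \<in> T then 1 + Z j else 1)" if j: "j < 2 ^ n" for j
  proof -
    have "msubst (sparse_gen n k j) (keep J) =
        1 + (\<Sum>i<k. if i = \<iota> j then (if j \<in> T then Z j else 0) else (0 :: 'a mpoly))"
      unfolding sparse_gen_def msubst_add msubst_sum msubst_mmonom mpow_keep keys_indicator_exp[OF finite_seed_block] sub_iff[OF j]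
      by (intro arg_cong2[where f = "(+)"] sum.cong) (auto simp: Z_def)
    then show ?thesis using \<iota>(2) by (auto simp: sum.delta)
  qed
  let ?H = "msubst F (shift_sub T)"
  have keep_eq: "msubst (msubst F (sparse_gen n k)) (keep J) = msubst ?H Z"
    unfolding msubst_msubst
    by (rule msubst_cong) (use F in \<open>auto simp: sparse_gen_keep shift_sub_def msubst_add subset_iff\<close>)
  \<comment> \<open>The exponent vector of the product of the Z_v to the powers m(v). Disjointness
    of the blocks makes it injective on exponent vectors supported in T.\<close>
  define L where "L m = (\<Sum>v\<in>T. \<Sum>x\<in>?B v. Poly_Mapping.single x (Poly_Mapping.lookup m v))" for m :: "nat \<Rightarrow>\<^sub>0 nat"
  have lookL: "Poly_Mapping.lookup (L m) x = (\<Sum>v\<in>T. if x \<in> ?B v then Poly_Mapping.lookup m v else 0)" for m x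
    by (simp add: L_def lookup_sum lookup_single when_def sum.delta)
  have lookL1: "Poly_Mapping.lookup (L m) x = Poly_Mapping.lookup m v" if "v \<in> T" "x \<in> ?B v" for m x v
  proof -
    have "Poly_Mapping.lookup (L m) x = (\<Sum>v'\<in>T. if v' = v then Poly_Mapping.lookup m v else 0)"
      unfolding lookL by (intro sum.cong refl) (use that owner in auto)
    then show ?thesis using that finT by (simp add: sum.delta)
  qed
  have keysH: "Poly_Mapping.keys m \<subseteq> T" if "m \<in> Poly_Mapping.keys ?H" for m
    using mvars_shift_sub[of F T] that by (auto simp: mvars_def)
  have injL: "m = w" if "m \<in> Poly_Mapping.keys ?H" "L m = L w" for m
  proof (rule poly_mapping_eqI)
    fix v
    show "Poly_Mapping.lookup m v = Poly_Mapping.lookup w v"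
    proof (cases "v \<in> T")
      case True
      have "\<iota> v * (2 * n + 1) \<in> ?B v" by (simp add: seed_block_def)
      from lookL1[OF True this] that(2) show ?thesis by metis
    next
      case False
      then show ?thesis using keysH[OF that(1)] keysH[OF w] by (metis in_keys_iff subsetD)
    qed
  qed
  have powZ: "mpow Z m = mmonom (L m)" if "m \<in> Poly_Mapping.keys ?H" for m
  proof -
    have pw: "(mmonom (indicator_exp (?B v)) :: 'a mpoly) ^ e = mmonom (\<Sum>x\<in>?B v. Poly_Mapping.single x e)" for v e
    proof (induction e)
      case (Suc e)
      have "(\<Sum>x\<in>?B v. Poly_Mapping.single x (Suc e)) = indicator_exp (?B v) + (\<Sum>x\<in>?B v. Poly_Mapping.single x e)"
        unfolding indicator_exp_def sum.distrib[symmetric] by (simp flip: single_add)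
      then show ?case by (simp add: mmonom_add Suc)
    qed simp
    show ?thesis
      by (simp add: mpow_superset[OF finT keysH[OF that]] Z_def pw L_def mmonom_sum)
  qed
  have "Poly_Mapping.lookup (msubst ?H Z) (L w) =
      (\<Sum>m\<in>Poly_Mapping.keys ?H. if m = w then Poly_Mapping.lookup ?H w else 0)"
    unfolding msubst_lin_ext[of ?H] lin_ext_def lookup_sum lookup_mconst_mult
    by (intro sum.cong refl) (use injL powZ in \<open>auto simp: lookup_mmonom\<close>)
  also have "\<dots> \<noteq> 0" using w by (simp add: sum.delta in_keys_iff)
  \<comment> \<open>Since \<open>keep J\<close> only deletes monomials, a monomial of the
    degenerated composition is one of the full composition.\<close>
  finally have "L w \<in> Poly_Mapping.keys (msubst F (sparse_gen n k))"
    unfolding keep_eq[symmetric] lookup_msubst_keep by (auto simp: in_keys_iff split: if_splits)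
  moreover have "Poly_Mapping.lookup (L w) x = 0 \<or> (\<exists>v. Poly_Mapping.lookup (L w) x = Poly_Mapping.lookup w v)" for x
  proof (cases "\<exists>v\<in>T. x \<in> ?B v")
    case True
    then show ?thesis using lookL1 by blast
  next
    case False
    then show ?thesis by (auto simp: lookL intro!: sum.neutral)
  qed
  ultimately show ?thesis by blast
qed

section \<open>Succinctness\<close>

lemma lf_poly_single:
  assumes "m < n"
  shows "lf_poly n (c, \<lambda>k. if k = m then y else 0) = mconst c + mconst y * mvar m"
proof -
  have "(\<Sum>k<n. mconst (if k = m then y else 0) * mvar k) = (\<Sum>k<n. if k = m then mconst y * mvar m else 0)"
    by (intro sum.cong) auto
  with assms show ?thesis by (simp add: lf_poly_def sum.delta)
qed

lemma lf_poly_const: "lf_poly n (c, \<lambda>_. 0) = mconst c"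
  by (simp add: lf_poly_def)

lemma lf_support_single: "lf_support n (c, \<lambda>k. if k = m then y else 0) \<subseteq> {m}"
  by (auto simp: lf_support_def)

definition gate :: "nat \<Rightarrow> 'a \<Rightarrow> (nat \<Rightarrow> 'a) \<Rightarrow> (nat \<Rightarrow> 'a) \<Rightarrow> 'a::comm_semiring_1 linform list" where
  "gate n z v y = (z, \<lambda>_. 0) # map (\<lambda>m. (v m, \<lambda>k. if k = m then y m else 0)) [0..<n]"

lemma gate_poly:
  "(\<Prod>l\<leftarrow>gate n z v y. lf_poly n l) = mconst z * (\<Prod>m<n. mconst (y m) * mvar m + mconst (v m))"
proof -
  have "(\<Prod>l\<leftarrow>gate n z v y. lf_poly n l) =
      mconst z * (\<Prod>m\<leftarrow>[0..<n]. lf_poly n (v m, \<lambda>k. if k = m then y m else 0))"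
    by (simp add: gate_def lf_poly_const o_def)
  also have "(\<Prod>m\<leftarrow>[0..<n]. lf_poly n (v m, \<lambda>k. if k = m then y m else 0)) =
      (\<Prod>m<n. lf_poly n (v m, \<lambda>k. if k = m then y m else 0))"
    by (simp add: prod.distinct_set_conv_list[symmetric] lessThan_atLeast0)
  also have "\<dots> = (\<Prod>m<n. mconst (y m) * mvar m + mconst (v m))"
    by (intro prod.cong) (auto simp: lf_poly_single add.commute)
  finally show ?thesis .
qed

lemma gate_disjoint:
  assumes "i < length (gate n z v y)" "j < length (gate n z v y)" "i \<noteq> j"
  shows "lf_support n (gate n z v y ! i) \<inter> lf_support n (gate n z v y ! j) = {}"
  using assms by (auto simp: gate_def lf_support_def nth_Cons split: nat.splits if_splits)

text \<open>One node for the product, two for the constant form and at most three for each of the n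
  other forms; a form has fewer when its seed y_m takes the value 0.\<close>

lemma gate_size: "1 + (\<Sum>l\<leftarrow>gate n z v y. 2 + card (lf_support n l)) \<le> 3 * n + 3"
proof -
  have "card (lf_support n (v m, \<lambda>k. if k = m then y m else 0)) \<le> 1" for m
    using card_mono[OF _ lf_support_single[of n "v m" m "y m"]] by simp
  then have "(\<Sum>m\<leftarrow>[0..<n]. 2 + card (lf_support n (v m, \<lambda>k. if k = m then y m else 0))) \<le> (\<Sum>m\<leftarrow>[0..<n]. 3)"
    by (intro sum_list_mono) (simp add: numeral_eq_Suc)
  then show ?thesis by (simp add: gate_def o_def lf_support_def sum_list_triv)
qed

lemma gate_expand:
  "(\<Prod>m<n. mconst (y m) * mvar m + mconst (v m)) =
     (\<Sum>S\<in>Pow {..<n}. mconst (\<Prod>m<n. if m \<in> S then y m else v m) * mono_x S)"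
proof -
  have "(\<Prod>m\<in>S. mconst (y m) * mvar m) * (\<Prod>m\<in>{..<n} - S. mconst (v m)) =
      mconst (\<Prod>m<n. if m \<in> S then y m else v m) * mono_x S" if "S \<subseteq> {..<n}" for S
  proof -
    have "(\<Prod>m<n. if m \<in> S then y m else v m) = (\<Prod>m\<in>S. y m) * (\<Prod>m\<in>{..<n} - S. v m)"
      using that by (simp add: prod.If_cases Int_absorb1 Diff_eq)
    then show ?thesis by (simp add: mconst_mult mconst_prod prod.distrib mono_x_def mult_ac)
  qed
  then show ?thesis by (simp add: prod_add)
qed

lemma set_code_eq: "set_code S = set_encode S"
  by (simp add: set_code_def set_encode_def)


lemma meval_sparse_gen:
  assumes "S \<subseteq> {..<n}"
  shows "mconst (meval (sparse_gen n k (set_code S)) \<alpha>) = (1 + (\<Sum>i<k. mconst (\<alpha> (i * (2 * n + 1))) *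
    mconst (\<Prod>m<n. if m \<in> S then \<alpha> (i * (2 * n + 1) + 1 + 2 * m + 1) else \<alpha> (i * (2 * n + 1) + 1 + 2 * m))))"
proof -
  have dec: "set_decode (set_code S) = S"
    using finite_subset[OF assms] by (simp add: set_code_eq)
  have "(\<Prod>a\<in>seed_block n i (set_code S). \<alpha> a) = \<alpha> (i * (2 * n + 1)) *
      (\<Prod>m<n. if m \<in> S then \<alpha> (i * (2 * n + 1) + 1 + 2 * m + 1) else \<alpha> (i * (2 * n + 1) + 1 + 2 * m))" for i
  proof -
    let ?f = "\<lambda>m. i * (2 * n + 1) + 1 + 2 * m + (if m \<in> S then 1 else 0)"
    have "inj_on ?f {..<n}" by (rule inj_onI) (simp split: if_splits; presburger)
    moreover have "i * (2 * n + 1) \<notin> ?f ` {..<n}" by auto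
    ultimately have "(\<Prod>a\<in>seed_block n i (set_code S). \<alpha> a) = \<alpha> (i * (2 * n + 1)) * (\<Prod>m<n. \<alpha> (?f m))"
      unfolding seed_block_def dec by (subst prod.insert) (simp_all add: prod.reindex o_def)
    also have "(\<Prod>m<n. \<alpha> (?f m)) = (\<Prod>m<n. if m \<in> S then \<alpha> (i * (2 * n + 1) + 1 + 2 * m + 1) else \<alpha> (i * (2 * n + 1) + 1 + 2 * m))"
      by (intro prod.cong) auto
    finally show ?thesis .
  qed
  then show ?thesis
    unfolding mconst_meval sparse_gen_def
    by (simp add: msubst_add msubst_sum msubst_mmonom mpow_indicator_exp flip: mconst_prod mconst_mult)
qed

lemma sparse_gen_formula:
  fixes \<alpha> :: "nat \<Rightarrow> 'a::comm_semiring_1"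
  shows "\<exists>C. sps_multilinear n C \<and> sps_size n C \<le> 1 + (k + 1) * (3 * n + 3) \<and>
    sps_poly n C = (\<Sum>S\<in>Pow {..<n}. mconst (meval (sparse_gen n k (set_code S)) \<alpha>) * mono_x S)"
proof -
  let ?z = "\<lambda>i. \<alpha> (i * (2 * n + 1))"
  let ?v = "\<lambda>i m. \<alpha> (i * (2 * n + 1) + 1 + 2 * m)"
  let ?y = "\<lambda>i m. \<alpha> (i * (2 * n + 1) + 1 + 2 * m + 1)"
  \<comment> \<open>The product of all 1 + x_m, whose coefficient vector is the all-ones
    vector.\<close>
  let ?one = "gate n 1 (\<lambda>_. 1) (\<lambda>_. 1) :: 'a linform list"
  let ?g = "\<lambda>i. gate n (?z i) (?v i) (?y i)"
  define C where "C = ?one # map ?g [0..<k]"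
  have "sps_multilinear n C"
    using gate_disjoint by (fastforce simp: sps_multilinear_def C_def)
  moreover have "sps_size n C \<le> 1 + (k + 1) * (3 * n + 3)"
  proof -
    have "\<exists>z v y. P = gate n z v y" if "P \<in> set C" for P
      using that by (auto simp: C_def)
    then have "(\<Sum>P\<leftarrow>C. 1 + (\<Sum>l\<leftarrow>P. 2 + card (lf_support n l))) \<le> (\<Sum>P\<leftarrow>C. 3 * n + 3)"
      by (intro sum_list_mono) (metis gate_size)
    also have "\<dots> = (k + 1) * (3 * n + 3)"
      unfolding sum_list_triv by (simp add: C_def)
    finally show ?thesis unfolding sps_size_def by linarith
  qed
  moreover have "sps_poly n C = (\<Sum>S\<in>Pow {..<n}. mconst (meval (sparse_gen n k (set_code S)) \<alpha>) * mono_x S)"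
  proof -
    have "sps_poly n C = (\<Prod>l\<leftarrow>?one. lf_poly n l) + (\<Sum>i\<leftarrow>[0..<k]. \<Prod>l\<leftarrow>?g i. lf_poly n l)"
      by (simp add: sps_poly_def C_def o_def)
    also have "(\<Sum>i\<leftarrow>[0..<k]. \<Prod>l\<leftarrow>?g i. lf_poly n l) = (\<Sum>i<k. \<Prod>l\<leftarrow>?g i. lf_poly n l)"
      by (simp add: sum.distinct_set_conv_list[symmetric] lessThan_atLeast0)
    also have "(\<Prod>l\<leftarrow>?one. lf_poly n l) + \<dots> = (\<Sum>S\<in>Pow {..<n}. mono_x S) +
        (\<Sum>i<k. \<Sum>S\<in>Pow {..<n}. mconst (?z i) * (mconst (\<Prod>m<n. if m \<in> S then ?y i m else ?v i m) * mono_x S))"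
      unfolding gate_poly gate_expand by (simp add: sum_distrib_left)
    also have "\<dots> = (\<Sum>S\<in>Pow {..<n}. mono_x S + (\<Sum>i<k. mconst (?z i) * (mconst (\<Prod>m<n. if m \<in> S then ?y i m else ?v i m) * mono_x S)))"
      by (subst sum.swap) (simp add: sum.distrib)
    also have "\<dots> = (\<Sum>S\<in>Pow {..<n}. mconst (meval (sparse_gen n k (set_code S)) \<alpha>) * mono_x S)"
      by (intro sum.cong refl) (simp only: Pow_iff meval_sparse_gen distrib_right mult_1 sum_distrib_right mult.assoc)
    finally show ?thesis .
  qed
  ultimately show ?thesis by blast
qed

section \<open>Counting monomials\<close>

definition exp_size :: "(nat \<Rightarrow>\<^sub>0 nat) \<Rightarrow> nat" where
  "exp_size m = (\<Sum>j\<in>Poly_Mapping.keys m. Poly_Mapping.lookup m j)"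

lemma exp_size_superset:
  assumes "finite M" "Poly_Mapping.keys m \<subseteq> M"
  shows "exp_size m = (\<Sum>j\<in>M. Poly_Mapping.lookup m j)"
  unfolding exp_size_def using assms by (intro sum.mono_neutral_left) (auto simp: in_keys_iff)

lemma exp_size_0 [simp]: "exp_size 0 = 0"
  by (simp add: exp_size_def)

lemma exp_size_single [simp]: "exp_size (Poly_Mapping.single v e) = e"
  by (simp add: exp_size_def)

lemma exp_size_add: "exp_size (a + b) = exp_size a + exp_size b"
proof -
  let ?M = "Poly_Mapping.keys a \<union> Poly_Mapping.keys b"
  have "Poly_Mapping.keys (a + b) \<subseteq> ?M" by (rule keys_add)
  then show ?thesis by (simp add: exp_size_superset[of ?M] lookup_add sum.distrib)
qed

lemma exp_size_mono:
  assumes "\<And>v. Poly_Mapping.lookup a v \<le> Poly_Mapping.lookup b v"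
  shows "exp_size a \<le> exp_size b"
proof -
  have "Poly_Mapping.keys a \<subseteq> Poly_Mapping.keys b"
    using assms by (metis in_keys_iff le_zero_eq subsetI)
  then show ?thesis using assms by (simp add: exp_size_superset[of "Poly_Mapping.keys b"] sum_mono)
qed

lemma exp_size_eq_0_iff: "exp_size m = 0 \<longleftrightarrow> m = 0"
  by (auto simp: exp_size_def in_keys_iff poly_mapping_eq_iff fun_eq_iff)

lemma tdeg_le_iff: "tdeg p \<le> t \<longleftrightarrow> (\<forall>m\<in>Poly_Mapping.keys p. exp_size m \<le> t)"
  by (simp add: tdeg_def exp_size_def)

definition monomials :: "nat set \<Rightarrow> nat \<Rightarrow> (nat \<Rightarrow>\<^sub>0 nat) set" where
  "monomials T D = {m. Poly_Mapping.keys m \<subseteq> T \<and> exp_size m \<le> D}"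

lemma split_single:
  assumes "Poly_Mapping.lookup m v > 0"
  shows "m = (m - Poly_Mapping.single v 1) + Poly_Mapping.single v (1::nat)"
  using assms by (intro poly_mapping_eqI) (auto simp: lookup_add lookup_minus lookup_single when_def)

text \<open>Pascal's rule: a monomial either omits v or is x_v times a monomial of degree one
  less.\<close>

lemma card_monomials: "finite T \<Longrightarrow> finite (monomials T D) \<and> card (monomials T D) = (card T + D) choose card T"
proof (induction T arbitrary: D rule: finite_induct)
  case empty
  have "monomials {} D = {0}" by (auto simp: monomials_def)
  then show ?case by simp
next
  case (insert v T)
  show ?case
  proof (induction D)
    case 0
    have "monomials (insert v T) 0 = {0}" by (auto simp: monomials_def exp_size_eq_0_iff)
    then show ?case by simp
  next
    case (Suc D)
    let ?f = "\<lambda>m. m + Poly_Mapping.single v (1::nat)"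
    have split: "monomials (insert v T) (Suc D) = monomials T (Suc D) \<union> ?f ` monomials (insert v T) D"
    proof (intro equalityI subsetI)
      fix m assume m: "m \<in> monomials (insert v T) (Suc D)"
      show "m \<in> monomials T (Suc D) \<union> ?f ` monomials (insert v T) D"
      proof (cases "Poly_Mapping.lookup m v > 0")
        case True
        let ?m = "m - Poly_Mapping.single v 1"
        from split_single[OF True] have eq: "m = ?f ?m" .
        from arg_cong[OF eq, of exp_size] have "exp_size m = Suc (exp_size ?m)" by (simp add: exp_size_add)
        moreover have "Poly_Mapping.keys ?m \<subseteq> Poly_Mapping.keys m"
          by (auto simp: in_keys_iff lookup_minus)
        ultimately have "?m \<in> monomials (insert v T) D" using m by (auto simp: monomials_def)
        with eq show ?thesis by blast
      next
        case False
        then show ?thesis using m by (auto simp: monomials_def in_keys_iff)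
      qed
    next
      fix m assume "m \<in> monomials T (Suc D) \<union> ?f ` monomials (insert v T) D"
      then show "m \<in> monomials (insert v T) (Suc D)"
        using keys_add[of _ "Poly_Mapping.single v (1::nat)"]
        by (fastforce simp: monomials_def exp_size_add)
    qed
    have disj: "monomials T (Suc D) \<inter> ?f ` monomials (insert v T) D = {}"
    proof -
      have "Poly_Mapping.lookup m v = 0" if "m \<in> monomials T (Suc D)" for m
        using that insert(2) by (auto simp: monomials_def in_keys_iff)
      then show ?thesis by (fastforce simp: lookup_add)
    qed
    have "card (?f ` monomials (insert v T) D) = card (monomials (insert v T) D)"
      by (intro card_image inj_onI) simp
    with split disj insert Suc show ?case by (simp add: card_Un_disjoint)
  qed
qed

lemmas finite_monomials = card_monomials[THEN conjunct1]

section \<open>A derivation and trailing monomials\<close>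

text \<open>\<open>euler_op v\<close> is \<open>(1 + x\<^sub>v) \<partial>/\<partial>x\<^sub>v\<close>, which is the Euler operator of \<open>x\<^sub>v\<close> seen after the translation by
  \<open>1\<close>: it multiplies translated monomials by scalars.\<close>

definition euler_op :: "nat \<Rightarrow> 'a mpoly \<Rightarrow> 'a::comm_ring_1 mpoly" where
  "euler_op v = lin_ext (\<lambda>m. mconst (of_nat (Poly_Mapping.lookup m v)) *
     (mmonom m + mmonom (m - Poly_Mapping.single v 1)))"

lemma lin_ext_Leibniz:
  assumes "\<And>a b. g (a + b) = g a * mmonom b + mmonom a * g b"
  shows "lin_ext g (p * q) = lin_ext g p * q + p * lin_ext g q"
proof -
  have "lin_ext g (p * q) = (\<Sum>a\<in>Poly_Mapping.keys p. \<Sum>b\<in>Poly_Mapping.keys q.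
      mconst (Poly_Mapping.lookup p a) * g a * (mconst (Poly_Mapping.lookup q b) * mmonom b) +
      mconst (Poly_Mapping.lookup p a) * mmonom a * (mconst (Poly_Mapping.lookup q b) * g b))"
    by (subst mult_expand) (simp add: lin_ext_sum lin_ext_mconst_mult assms algebra_simps)
  also have "\<dots> = lin_ext g p * q + p * lin_ext g q"
    unfolding lin_ext_def sum.distrib sum_product[symmetric] mpoly_expand[symmetric] ..
  finally show ?thesis .
qed

lemma euler_op_mult: "euler_op v (p * q) = euler_op v p * q + p * euler_op v q"
  unfolding euler_op_def
proof (rule lin_ext_Leibniz)
  fix a b :: "nat \<Rightarrow>\<^sub>0 nat"
  let ?e = "Poly_Mapping.single v (1::nat)"
  \<comment> \<open>Subtraction of exponents is truncated, so it commutes with adding b only when a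
    contains x_v. Otherwise the scalar factor is 0.\<close>
  have shift: "mconst (of_nat (Poly_Mapping.lookup a v)) * mmonom (a + b - ?e) =
      mconst (of_nat (Poly_Mapping.lookup a v)) * (mmonom (a - ?e) * mmonom b :: 'a mpoly)" for a b
  proof (cases "Poly_Mapping.lookup a v > 0")
    case True
    then have "a + b - ?e = (a - ?e) + b"
      by (intro poly_mapping_eqI) (auto simp: lookup_add lookup_minus lookup_single when_def)
    then show ?thesis by (simp add: mmonom_add)
  qed simp
  show "mconst (of_nat (Poly_Mapping.lookup (a + b) v)) * (mmonom (a + b) + mmonom (a + b - ?e)) =
      mconst (of_nat (Poly_Mapping.lookup a v)) * (mmonom a + mmonom (a - ?e)) * mmonom b +
      mmonom a * (mconst (of_nat (Poly_Mapping.lookup b v)) * (mmonom b + mmonom (b - ?e)) :: 'a mpoly)"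
    using shift[of a b] shift[of b a]
    by (simp add: lookup_add mconst_add distrib_left distrib_right mmonom_add add_ac mult_ac)
qed

lemma euler_op_add: "euler_op v (p + q) = euler_op v p + euler_op v q"
  by (simp add: euler_op_def lin_ext_add)

lemma euler_op_sum: "euler_op v (sum f A) = (\<Sum>x\<in>A. euler_op v (f x))"
  by (simp add: euler_op_def lin_ext_sum)

lemma euler_op_mconst_mult: "euler_op v (mconst c * p) = mconst c * euler_op v p"
  by (simp add: euler_op_def lin_ext_mconst_mult)

lemma euler_op_1 [simp]: "euler_op v 1 = 0"
  unfolding euler_op_def mmonom_0[symmetric] lin_ext_mmonom by simp

lemma euler_op_mvar: "euler_op v (mvar j) = (if j = v then 1 + mvar v else 0)"
  by (auto simp: euler_op_def mvar_eq_mmonom lookup_single add.commute)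

lemma euler_op_power: "euler_op v (p ^ d) = of_nat d * p ^ (d - 1) * euler_op v p"
proof (induction d)
  case (Suc d)
  then show ?case
    by (cases d) (auto simp: euler_op_mult algebra_simps)
qed simp

lemma keys_dopE:
  assumes "k \<in> Poly_Mapping.keys (euler_op v p)"
  obtains m where "m \<in> Poly_Mapping.keys p" "Poly_Mapping.lookup m v > 0"
    "k = m \<or> k = m - Poly_Mapping.single v 1"
proof -
  from assms obtain m where m: "m \<in> Poly_Mapping.keys p" "k \<in> Poly_Mapping.keys (mconst (Poly_Mapping.lookup p m) *
     (mconst (of_nat (Poly_Mapping.lookup m v)) * (mmonom m + mmonom (m - Poly_Mapping.single v 1))))"
    unfolding euler_op_def lin_ext_def by (rule keys_sumE)
  then have "Poly_Mapping.lookup m v > 0" by (intro Nat.gr0I) auto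
  moreover have "k = m \<or> k = m - Poly_Mapping.single v 1"
    using m(2) by (auto simp: in_keys_iff lookup_mconst_mult lookup_add lookup_mmonom split: if_splits)
  ultimately show ?thesis using that m(1) by blast
qed

text \<open>The order is the lexicographic one of finitely supported maps. It is linear and
  compatible with addition, so multiplication by a monomial shifts trailing monomials.\<close>

definition trailing :: "'a::zero mpoly \<Rightarrow> (nat \<Rightarrow>\<^sub>0 nat) \<Rightarrow> bool" where
  "trailing p w \<longleftrightarrow> w \<in> Poly_Mapping.keys p \<and> (\<forall>m\<in>Poly_Mapping.keys p. w \<le> m)"

lemma ex_trailing: "p \<noteq> 0 \<Longrightarrow> \<exists>w. trailing p w"
  unfolding trailing_def by (metis Min_in Min_le finite_keys keys_eq_empty)

lemma single_pos: "(0 :: nat \<Rightarrow>\<^sub>0 nat) < Poly_Mapping.single v 1"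
  by (auto simp: less_poly_mapping.rep_eq less_fun_def lookup_single when_def intro!: exI[of _ v])

text \<open>A monomial m divisible by x_v contributes at m and at m - e_v, the second being smaller,
  and subtracting e_v preserves the order. So nothing lies below w - e_v, and only w itself
  contributes there, with its coefficient times w(v). This scalar must survive in the field.\<close>

lemma trailing_euler_op:
  fixes p :: "'a::field mpoly"
  assumes tr: "trailing p w" and nz: "of_nat (Poly_Mapping.lookup w v) \<noteq> (0 :: 'a)"
  shows "trailing (euler_op v p) (w - Poly_Mapping.single v 1)"
proof -
  let ?e = "Poly_Mapping.single v (1::nat)"
  have wv: "Poly_Mapping.lookup w v > 0" using nz by (intro Nat.gr0I) auto
  have less: "m - ?e < m" if "Poly_Mapping.lookup m v > 0" for m
    using split_single[OF that] add_strict_left_mono[OF single_pos, of "m - ?e" v] by simp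
  have mono: "w - ?e \<le> m - ?e" if "Poly_Mapping.lookup m v > 0" "w \<le> m" for m
    using that(2) by (subst (asm) split_single[OF wv], subst (asm) split_single[OF that(1)]) simp
  have min: "w \<le> m" if "m \<in> Poly_Mapping.keys p" for m
    using tr that by (simp add: trailing_def)
  have "w - ?e \<le> k" if k: "k \<in> Poly_Mapping.keys (euler_op v p)" for k
  proof (rule keys_dopE[OF k])
    fix m assume m: "m \<in> Poly_Mapping.keys p" "Poly_Mapping.lookup m v > 0" "k = m \<or> k = m - ?e"
    have "w - ?e \<le> m - ?e" using mono[OF m(2) min[OF m(1)]] .
    with m(3) less[OF m(2)] show ?thesis by auto
  qed
  moreover have "w - ?e \<in> Poly_Mapping.keys (euler_op v p)"
  proof -
    have "Poly_Mapping.lookup (euler_op v p) (w - ?e) = (\<Sum>m\<in>Poly_Mapping.keys p.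
        if m = w then Poly_Mapping.lookup p w * of_nat (Poly_Mapping.lookup w v) else 0)"
      unfolding euler_op_def lin_ext_def lookup_sum
    proof (intro sum.cong refl)
      fix m assume m: "m \<in> Poly_Mapping.keys p"
      have "m \<noteq> w - ?e" using min[OF m] less[OF wv] by auto
      moreover have "m = w" if "Poly_Mapping.lookup m v > 0" "w - ?e = m - ?e"
        using split_single[OF wv] split_single[OF that(1)] that(2) by metis
      ultimately show "Poly_Mapping.lookup (mconst (Poly_Mapping.lookup p m) *
          (mconst (of_nat (Poly_Mapping.lookup m v)) * (mmonom m + mmonom (m - ?e)))) (w - ?e) =
          (if m = w then Poly_Mapping.lookup p w * of_nat (Poly_Mapping.lookup w v) else 0)"
        by (cases "Poly_Mapping.lookup m v = 0") (auto simp: lookup_mconst_mult lookup_add lookup_mmonom)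
    qed
    also have "\<dots> \<noteq> 0" using tr nz by (auto simp: trailing_def sum.delta in_keys_iff)
    finally show ?thesis by (simp add: in_keys_iff)
  qed
  ultimately show ?thesis by (simp add: trailing_def)
qed

lemma trailing_mmonom_mult:
  fixes p :: "'a::comm_semiring_1 mpoly"
  assumes "trailing p w"
  shows "trailing (mmonom b * p) (b + w)"
  using assms unfolding trailing_def
  by (auto simp: in_keys_iff lookup_mmonom_mult_add elim!: keys_multE)

definition euler_ops :: "nat set \<Rightarrow> 'a mpoly \<Rightarrow> 'a::comm_ring_1 mpoly" where
  "euler_ops A = foldr euler_op (sorted_list_of_set A)"

text \<open>The variables in A are distinct, so when the operator of v is applied the exponent of v
  is still w(v). Hence a condition on w alone covers all steps.\<close>

lemma trailing_euler_ops:
  fixes p :: "'a::field mpoly"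
  assumes tr: "trailing p w" and A: "finite A" "\<And>v. v \<in> A \<Longrightarrow> of_nat (Poly_Mapping.lookup w v) \<noteq> (0 :: 'a)"
  shows "trailing (euler_ops A p) (w - indicator_exp A)"
proof -
  have "trailing (foldr euler_op vs p) (w - indicator_exp (set vs))"
    if "distinct vs" "\<And>v. v \<in> set vs \<Longrightarrow> of_nat (Poly_Mapping.lookup w v) \<noteq> (0 :: 'a)" for vs
    using that
  proof (induction vs)
    case Nil
    then show ?case using tr by (simp add: indicator_exp_def)
  next
    case (Cons v vs)
    have "trailing (foldr euler_op vs p) (w - indicator_exp (set vs))" using Cons by simp
    moreover have "Poly_Mapping.lookup (w - indicator_exp (set vs)) v = Poly_Mapping.lookup w v"
      using Cons(2) by (simp add: lookup_minus lookup_indicator_exp)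
    ultimately have "trailing (euler_op v (foldr euler_op vs p)) (w - indicator_exp (set vs) - Poly_Mapping.single v 1)"
      using Cons(3) by (intro trailing_euler_op) auto
    moreover have "w - indicator_exp (set vs) - Poly_Mapping.single v 1 = w - indicator_exp (set (v # vs))"
      using Cons(2) by (intro poly_mapping_eqI) (auto simp: lookup_minus lookup_indicator_exp lookup_single when_def)
    ultimately show ?case by simp
  qed
  from this[of "sorted_list_of_set A"] A show ?thesis by (simp add: euler_ops_def)
qed

section \<open>Dimension counts from trailing monomials, and common eigenvectors\<close>

interpretation mp: vector_space "\<lambda>c (p :: 'a::field mpoly). mconst c * p"
  by standard (simp_all add: distrib_left distrib_right mconst_add mconst_mult mult.assoc)

text \<open>Polynomials with distinct trailing monomials are linearly independent: in a vanishing
  combination, the smallest trailing monomial with a nonzero scalar occurs in no other summand, so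
  it cannot cancel.\<close>

lemma card_le_of_trailing:
  fixes q :: "'i \<Rightarrow> 'a::field mpoly"
  assumes I: "finite I" and tr: "\<And>i. i \<in> I \<Longrightarrow> trailing (q i) (e i)" and inj: "inj_on e I"
    and B: "finite B" "\<And>i. i \<in> I \<Longrightarrow> q i \<in> mp.span B"
  shows "card I \<le> card B"
proof -
  have injq: "inj_on q I"
  proof (rule inj_onI)
    fix i j assume ij: "i \<in> I" "j \<in> I" "q i = q j"
    then have "e i = e j" using tr[of i] tr[of j] unfolding trailing_def by (metis order.antisym)
    then show "i = j" using inj ij by (meson inj_onD)
  qed
  have "mp.independent (q ` I)"
  proof (rule ccontr)
    assume "\<not> ?thesis"
    then obtain u where u: "\<exists>v\<in>q ` I. u v \<noteq> 0" "(\<Sum>v\<in>q ` I. mconst (u v) * v) = 0"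
      using mp.dependent_finite[of "q ` I"] I by auto
    define J where "J = {i\<in>I. u (q i) \<noteq> 0}"
    have J: "finite J" "J \<noteq> {}" using I u(1) by (auto simp: J_def)
    then have "Min (e ` J) \<in> e ` J" by simp
    then obtain i where i: "i \<in> J" "Min (e ` J) = e i" by auto
    have i_min: "e i \<le> e j" if "j \<in> J" for j
      unfolding i(2)[symmetric] using J(1) that by simp
    have "0 = Poly_Mapping.lookup (\<Sum>j\<in>I. mconst (u (q j)) * q j) (e i)"
      using u(2) by (simp add: sum.reindex[OF injq])
    also have "\<dots> = (\<Sum>j\<in>I. if j = i then u (q i) * Poly_Mapping.lookup (q i) (e i) else 0)"
      unfolding lookup_sum lookup_mconst_mult
    proof (intro sum.cong refl)
      fix j assume j: "j \<in> I"
      have "Poly_Mapping.lookup (q j) (e i) = 0" if "j \<in> J" "j \<noteq> i"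
      proof (rule ccontr)
        assume "\<not> ?thesis"
        then have "e j \<le> e i" using tr[OF j] by (auto simp: trailing_def in_keys_iff)
        with i_min[OF that(1)] have "e i = e j" by (auto intro: order.antisym)
        with inj i(1) j that(2) show False by (auto simp: J_def dest: inj_onD)
      qed
      with j show "u (q j) * Poly_Mapping.lookup (q j) (e i) =
          (if j = i then u (q i) * Poly_Mapping.lookup (q i) (e i) else 0)"
        by (auto simp: J_def)
    qed
    also have "\<dots> = u (q i) * Poly_Mapping.lookup (q i) (e i)"
      using i(1) I by (auto simp: sum.delta J_def)
    also have "\<dots> \<noteq> 0" using i(1) tr[of i] by (auto simp: J_def trailing_def in_keys_iff)
    finally show False by simp
  qed
  from mp.independent_span_bound[OF B(1) this] B(2) have "card (q ` I) \<le> card B" by auto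
  then show ?thesis by (simp add: card_image[OF injq])
qed


lemma foldr_euler_op_sum: "foldr euler_op vs (sum f A) = (\<Sum>x\<in>A. foldr euler_op vs (f x))"
  by (induction vs) (auto simp: euler_op_sum)

lemma foldr_euler_op_mconst_mult: "foldr euler_op vs (mconst c * p) = mconst c * foldr euler_op vs p"
  by (induction vs) (auto simp: euler_op_mconst_mult)

text \<open>The translated monomials are of this kind. An eigenvector factor can be carried through
  any number of operators unchanged, whatever its degree.\<close>

definition eigen :: "'a::comm_ring_1 mpoly \<Rightarrow> bool" where
  "eigen X \<longleftrightarrow> (\<forall>v. \<exists>c. euler_op v X = mconst c * X)"

lemma eigen_1: "eigen 1"
  by (auto simp: eigen_def intro!: exI[of _ 0])

lemma eigen_mult:
  assumes "eigen X" "eigen Y"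
  shows "eigen (X * Y)"
  unfolding eigen_def
proof
  fix v
  obtain c d where "euler_op v X = mconst c * X" "euler_op v Y = mconst d * Y"
    using assms unfolding eigen_def by metis
  then have "euler_op v (X * Y) = mconst (c + d) * (X * Y)"
    by (simp add: euler_op_mult mconst_add algebra_simps)
  then show "\<exists>c. euler_op v (X * Y) = mconst c * (X * Y)" ..
qed

lemma eigen_shift_sub: "eigen (shift_sub T j)"
proof (cases "j \<in> T")
  case True
  then have "euler_op v (shift_sub T j) = mconst (if j = v then 1 else 0) * (shift_sub T j :: 'a mpoly)" for v
    by (simp add: shift_sub_def euler_op_add euler_op_mvar)
  then show ?thesis unfolding eigen_def by blast
qed (simp add: shift_sub_def eigen_1)

lemma eigen_power: "eigen X \<Longrightarrow> eigen (X ^ e)"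
  by (induction e) (simp_all add: eigen_1 eigen_mult)

lemma eigen_prod: "(\<And>i. i \<in> A \<Longrightarrow> eigen (f i)) \<Longrightarrow> eigen (prod f A)"
  by (induction A rule: infinite_finite_induct) (simp_all add: eigen_1 eigen_mult)

lemma eigen_mpow_shift_sub: "eigen (mpow (shift_sub T) a)"
  unfolding mpow_def by (intro eigen_prod eigen_power eigen_shift_sub)

section \<open>Minimal supports\<close>

text \<open>Take T of least cardinality with a nonzero restriction. If some monomial missed a
  variable v of T, it would survive setting x_v to 0, and T - {v} would do as well.\<close>

lemma ex_minimal_support:
  fixes F :: "'a::comm_ring_1 mpoly"
  assumes "F \<noteq> 0" "mvars F \<subseteq> V" "finite V"
  shows "\<exists>T\<subseteq>V. msubst F (shift_sub T) \<noteq> 0 \<and> (\<forall>m\<in>Poly_Mapping.keys (msubst F (shift_sub T)). Poly_Mapping.keys m = T)"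
proof -
  let ?P = "\<lambda>T. T \<subseteq> V \<and> msubst F (shift_sub T) \<noteq> 0"
  \<comment> \<open>The translation is undone by subtracting 1 from each variable, so V itself is a
    candidate.\<close>
  have "msubst (msubst F (shift_sub V)) (\<lambda>v. mvar v - 1) = msubst F mvar"
    unfolding msubst_msubst
    by (rule msubst_cong) (use assms(2) in \<open>auto simp: shift_sub_def msubst_add\<close>)
  then have "?P V" using assms(1) by auto
  then obtain T where T: "?P T" "\<And>T'. ?P T' \<Longrightarrow> card T \<le> card T'"
    using arg_min_nat_lemma[of ?P V card] by blast
  have finT: "finite T" using T(1) assms(3) finite_subset by blast
  have "Poly_Mapping.keys m = T" if m: "m \<in> Poly_Mapping.keys (msubst F (shift_sub T))" for m
  proof (rule ccontr)
    assume "Poly_Mapping.keys m \<noteq> T"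
    moreover have "Poly_Mapping.keys m \<subseteq> T"
      using mvars_shift_sub[of F T] m unfolding mvars_subset_iff by blast
    ultimately obtain v where v: "v \<in> T" "Poly_Mapping.keys m \<subseteq> T - {v}" by blast
    have "msubst (msubst F (shift_sub T)) (keep (T - {v})) = msubst F (shift_sub (T - {v}))"
      unfolding msubst_msubst by (rule msubst_cong) (auto simp: shift_sub_def keep_def msubst_add)
    moreover have "Poly_Mapping.lookup (msubst (msubst F (shift_sub T)) (keep (T - {v}))) m \<noteq> 0"
      using v m by (simp add: lookup_msubst_keep in_keys_iff)
    ultimately have "?P (T - {v})" using T(1) by auto
    from T(2)[OF this] v(1) finT show False
      by (metis card_Diff1_less not_le)
  qed
  with T(1) show ?thesis by blast
qed

text \<open>Replacing a variable by 1 + x_v or by 1 never raises an exponent. The bound is stated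
  variable by variable because it is used both for total degrees and for exponents below p.\<close>

lemma keys_shift_sub_le:
  assumes "m \<in> Poly_Mapping.keys (msubst F (shift_sub T))"
  shows "\<exists>m'\<in>Poly_Mapping.keys F. \<forall>v. Poly_Mapping.lookup m v \<le> Poly_Mapping.lookup m' v"
proof -
  have pow: "\<forall>a\<in>Poly_Mapping.keys ((shift_sub T j :: 'a mpoly) ^ e). \<forall>v. Poly_Mapping.lookup a v \<le> (if v = j then e else 0)" for j e
  proof (induction e)
    case (Suc e)
    have s: "Poly_Mapping.lookup b v \<le> (if v = j then 1 else 0)" if "b \<in> Poly_Mapping.keys (shift_sub T j :: 'a mpoly)" for b v
      using that keys_add[of "1 :: 'a mpoly" "mvar j"]
      by (auto simp: shift_sub_def mvar_eq_mmonom lookup_single split: if_splits)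
    show ?case
    proof (intro ballI allI)
      fix a v assume "a \<in> Poly_Mapping.keys ((shift_sub T j :: 'a mpoly) ^ Suc e)"
      then obtain b c where "a = b + c" "b \<in> Poly_Mapping.keys (shift_sub T j :: 'a mpoly)" "c \<in> Poly_Mapping.keys ((shift_sub T j :: 'a mpoly) ^ e)"
        unfolding power_Suc by (rule keys_multE)
      with s[of b v] Suc show "Poly_Mapping.lookup a v \<le> (if v = j then Suc e else 0)"
        by (fastforce simp: lookup_add split: if_splits)
    qed
  qed simp
  have prods: "\<forall>a\<in>Poly_Mapping.keys (\<Prod>j\<in>K. (shift_sub T j :: 'a mpoly) ^ e j). \<forall>v. Poly_Mapping.lookup a v \<le> (if v \<in> K then e v else 0)" if "finite K" for K e
    using that
  proof (induction K rule: finite_induct)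
    case (insert j K)
    show ?case
    proof (intro ballI allI)
      fix a v assume "a \<in> Poly_Mapping.keys (\<Prod>j\<in>insert j K. (shift_sub T j :: 'a mpoly) ^ e j)"
      then obtain b c where "a = b + c" "b \<in> Poly_Mapping.keys ((shift_sub T j :: 'a mpoly) ^ e j)" "c \<in> Poly_Mapping.keys (\<Prod>j\<in>K. (shift_sub T j :: 'a mpoly) ^ e j)"
        unfolding prod.insert[OF insert(1,2)] by (rule keys_multE)
      with pow[of j "e j"] insert show "Poly_Mapping.lookup a v \<le> (if v \<in> insert j K then e v else 0)"
        by (fastforce simp: lookup_add split: if_splits)
    qed
  qed simp
  from assms obtain m' where m': "m' \<in> Poly_Mapping.keys F" "m \<in> Poly_Mapping.keys (mconst (Poly_Mapping.lookup F m') * mpow (shift_sub T) m')"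
    unfolding msubst_lin_ext lin_ext_def by (rule keys_sumE)
  from m'(2) have m: "m \<in> Poly_Mapping.keys (mpow (shift_sub T) m' :: 'a mpoly)"
    using keys_mconst_mult_subset by blast
  have "Poly_Mapping.lookup m v \<le> Poly_Mapping.lookup m' v" for v
  proof -
    have "Poly_Mapping.lookup m v \<le> (if v \<in> Poly_Mapping.keys m' then Poly_Mapping.lookup m' v else 0)"
      using prods[OF finite_keys[of m'], where e = "Poly_Mapping.lookup m'"] m unfolding mpow_def by blast
    then show ?thesis by (simp split: if_splits)
  qed
  with m'(1) show ?thesis by blast
qed

lemma foldr_euler_op_eigen: "eigen X \<Longrightarrow> \<exists>c. foldr euler_op vs X = mconst c * X"
proof (induction vs)
  case Nil
  show ?case by (intro exI[of _ 1]) simp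
next
  case (Cons v vs)
  then obtain c d where "foldr euler_op vs X = mconst c * X" "euler_op v X = mconst d * X"
    unfolding eigen_def by metis
  then have "foldr euler_op (v # vs) X = mconst (c * d) * X"
    by (simp add: euler_op_mconst_mult mconst_mult mult.assoc)
  then show ?case ..
qed

text \<open>Each subset A of T yields one polynomial, obtained by applying the operators of A. Their
  trailing monomials w minus the indicator of A are distinct, as w is positive on T. On the other
  side, every translated monomial of F is an eigenvector, so all these polynomials stay in a space
  spanned by as many elements as F has monomials.\<close>

lemma sparse_support_bound:
  fixes F :: "'a::field mpoly"
  assumes nz: "msubst F (shift_sub T) \<noteq> 0" and T: "finite T"
    and supp: "\<And>m v. m \<in> Poly_Mapping.keys (msubst F (shift_sub T)) \<Longrightarrow> v \<in> T \<Longrightarrow> of_nat (Poly_Mapping.lookup m v) \<noteq> (0 :: 'a)"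
  shows "2 ^ card T \<le> card (Poly_Mapping.keys F)"
proof -
  let ?H = "msubst F (shift_sub T)"
  obtain w where w: "trailing ?H w" using ex_trailing[OF nz] by blast
  then have wT: "of_nat (Poly_Mapping.lookup w v) \<noteq> (0 :: 'a)" if "v \<in> T" for v
    using supp that by (auto simp: trailing_def)
  have "card (Pow T) \<le> card (mpow (shift_sub T) ` Poly_Mapping.keys F :: 'a mpoly set)"
  proof (rule card_le_of_trailing)
    show "trailing (euler_ops A ?H) (w - indicator_exp A)" if "A \<in> Pow T" for A
      using that wT finite_subset[OF _ T] by (intro trailing_euler_ops w) auto
    show "inj_on (\<lambda>A. w - indicator_exp A) (Pow T)"
    proof (rule inj_onI)
      fix A B assume AB: "A \<in> Pow T" "B \<in> Pow T" "w - indicator_exp A = w - indicator_exp B"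
      then have fin: "finite A" "finite B" using finite_subset[OF _ T] by auto
      have "v \<in> A \<longleftrightarrow> v \<in> B" if "v \<in> T" for v
      proof -
        have "Poly_Mapping.lookup w v > 0" using wT[OF that] by (intro Nat.gr0I) auto
        moreover have "Poly_Mapping.lookup (w - indicator_exp A) v = Poly_Mapping.lookup (w - indicator_exp B) v" using AB(3) by simp
        ultimately show ?thesis using fin by (auto simp: lookup_minus lookup_indicator_exp split: if_splits)
      qed
      with AB show "A = B" by blast
    qed
    show "euler_ops A ?H \<in> mp.span (mpow (shift_sub T) ` Poly_Mapping.keys F)" if "A \<in> Pow T" for A
      unfolding msubst_lin_ext lin_ext_def euler_ops_def foldr_euler_op_sum foldr_euler_op_mconst_mult
    proof (intro mp.span_sum mp.span_scale)
      fix m assume m: "m \<in> Poly_Mapping.keys F"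
      obtain c where c: "foldr euler_op (sorted_list_of_set A) (mpow (shift_sub T) m) = mconst c * (mpow (shift_sub T) m :: 'a mpoly)"
        using foldr_euler_op_eigen[OF eigen_mpow_shift_sub] by blast
      show "foldr euler_op (sorted_list_of_set A) (mpow (shift_sub T) m :: 'a mpoly) \<in> mp.span (mpow (shift_sub T) ` Poly_Mapping.keys F)"
        unfolding c by (intro mp.span_scale mp.span_base imageI m)
    qed
  qed (use T in auto)
  also have "\<dots> \<le> card (Poly_Mapping.keys F)" by (rule card_image_le) simp
  finally show ?thesis using T by (simp add: card_Pow)
qed

section \<open>Shifted partial derivatives\<close>

lemma monomials_mono: "D \<le> E \<Longrightarrow> monomials T D \<subseteq> monomials T E"
  by (auto simp: monomials_def)

lemma monomials_add: "a \<in> monomials T D \<Longrightarrow> b \<in> monomials T E \<Longrightarrow> a + b \<in> monomials T (D + E)"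
  using keys_add[of a b] by (auto simp: monomials_def exp_size_add add_mono)

lemma keys_mult_monomials:
  "Poly_Mapping.keys p \<subseteq> monomials T D \<Longrightarrow> Poly_Mapping.keys q \<subseteq> monomials T E \<Longrightarrow> Poly_Mapping.keys (p * q) \<subseteq> monomials T (D + E)"
  using monomials_add by (blast elim: keys_multE)

lemma keys_add_monomials:
  "Poly_Mapping.keys p \<subseteq> monomials T D \<Longrightarrow> Poly_Mapping.keys q \<subseteq> monomials T D \<Longrightarrow> Poly_Mapping.keys (p + q) \<subseteq> monomials T D"
  using keys_add[of p q] by blast

lemma keys_mconst_mult_monomials:
  "Poly_Mapping.keys (p :: 'a::comm_semiring_1 mpoly) \<subseteq> monomials T D \<Longrightarrow> Poly_Mapping.keys (mconst c * p) \<subseteq> monomials T D"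
  using keys_mconst_mult_subset by blast

lemma keys_euler_op_monomials:
  assumes "Poly_Mapping.keys p \<subseteq> monomials T D"
  shows "Poly_Mapping.keys (euler_op v p) \<subseteq> monomials T D"
proof
  fix k assume "k \<in> Poly_Mapping.keys (euler_op v p)"
  then obtain m where m: "m \<in> Poly_Mapping.keys p" "k = m \<or> k = m - Poly_Mapping.single v 1"
    by (rule keys_dopE)
  then have le: "Poly_Mapping.lookup k j \<le> Poly_Mapping.lookup m j" for j
    by (auto simp: lookup_minus)
  have "Poly_Mapping.keys k \<subseteq> Poly_Mapping.keys m"
  proof
    fix j assume "j \<in> Poly_Mapping.keys k"
    with le[of j] show "j \<in> Poly_Mapping.keys m" by (simp add: in_keys_iff)
  qed
  moreover have "Poly_Mapping.keys m \<subseteq> T" "exp_size m \<le> D" using m(1) assms by (auto simp: monomials_def)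
  ultimately show "k \<in> monomials T D" using exp_size_mono[of k m] le by (simp add: monomials_def)
qed

text \<open>Product rule: pulling out one power of g less leaves a cofactor whose terms contain g or
  its derivative once more, so its degree bound grows by t. The operator itself does not raise
  degrees.\<close>

lemma euler_op_form:
  assumes X: "eigen X" and g: "Poly_Mapping.keys g \<subseteq> monomials T t" and Q: "Poly_Mapping.keys Q \<subseteq> monomials T D"
  shows "\<exists>Q'. Poly_Mapping.keys Q' \<subseteq> monomials T (D + t) \<and> euler_op v (X * g ^ d * Q) = X * g ^ (d - 1) * Q'"
proof -
  obtain c where c: "euler_op v X = mconst c * X" using X unfolding eigen_def by blast
  have Q1: "Poly_Mapping.keys (mconst c * Q + euler_op v Q) \<subseteq> monomials T D"
    by (intro keys_add_monomials keys_mconst_mult_monomials keys_euler_op_monomials Q)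
  show ?thesis
  proof (cases d)
    \<comment> \<open>Here d - 1 is again 0 by truncation: there is no power to give up, and the
      bound D + t is merely generous. This case lets the iterated form cover exponents smaller than
      the number of operators.\<close>
    case 0
    have "euler_op v (X * g ^ d * Q) = X * g ^ (d - 1) * (mconst c * Q + euler_op v Q)"
      by (simp add: 0 euler_op_mult c algebra_simps)
    moreover have "monomials T D \<subseteq> monomials T (D + t)" by (rule monomials_mono) simp
    ultimately show ?thesis using Q1 by blast
  next
    case (Suc e)
    let ?Q = "g * (mconst c * Q + euler_op v Q) + mconst (of_nat d) * (euler_op v g * Q)"
    have "Poly_Mapping.keys ?Q \<subseteq> monomials T (D + t)"
      unfolding add.commute[of D t]
      by (intro keys_add_monomials keys_mult_monomials g Q1 keys_mconst_mult_monomials keys_euler_op_monomials Q)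
    moreover have "euler_op v (X * g ^ d * Q) = X * g ^ (d - 1) * ?Q"
      unfolding euler_op_mult euler_op_power c Suc of_nat_mpoly[symmetric] by (simp add: algebra_simps)
    ultimately show ?thesis by blast
  qed
qed

lemma foldr_euler_op_form:
  assumes X: "eigen X" and g: "Poly_Mapping.keys g \<subseteq> monomials T t"
  shows "\<exists>Q'. Poly_Mapping.keys Q' \<subseteq> monomials T (length vs * t) \<and>
    foldr euler_op vs (X * g ^ d) = X * g ^ (d - length vs) * Q'"
proof (induction vs)
  case Nil
  show ?case by (intro exI[of _ 1]) (auto simp: monomials_def)
next
  case (Cons v vs)
  then obtain Q where Q: "Poly_Mapping.keys Q \<subseteq> monomials T (length vs * t)"
    "foldr euler_op vs (X * g ^ d) = X * g ^ (d - length vs) * Q" by blast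
  from euler_op_form[OF X g Q(1), of v "d - length vs"] Q(2) show ?case
    by (simp add: add.commute)
qed

lemma span_shifts:
  fixes Y :: "'a::field mpoly"
  assumes "Poly_Mapping.keys Q \<subseteq> M"
  shows "Y * Q \<in> mp.span ((\<lambda>e. Y * mmonom e) ` M)"
proof -
  have "Y * Q = (\<Sum>e\<in>Poly_Mapping.keys Q. mconst (Poly_Mapping.lookup Q e) * (Y * mmonom e))"
    by (subst mpoly_expand[of Q]) (simp add: sum_distrib_left mult_ac)
  also have "\<dots> \<in> mp.span ((\<lambda>e. Y * mmonom e) ` M)"
    using assms by (intro mp.span_sum mp.span_scale mp.span_base imageI) blast
  finally show ?thesis .
qed

text \<open>Write l for the cardinality of T. The left side counts pairs of a k-subset A of T and a
  monomial b of degree at most l in T - A. Each pair gives b times the operators of A applied to H,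
  with its own trailing monomial. The right side counts spanning elements: for each of the s
  summands, a fixed factor times the monomials in T of degree at most k t + l.\<close>

lemma shifted_partials_bound:
  fixes X g :: "nat \<Rightarrow> 'a::field mpoly"
  assumes H: "H = (\<Sum>i<s. X i * g i ^ d i)" "H \<noteq> 0" and T: "finite T"
    and supp: "\<And>m. m \<in> Poly_Mapping.keys H \<Longrightarrow> Poly_Mapping.keys m = T"
    and char0: "\<And>r. r > 0 \<Longrightarrow> of_nat r \<noteq> (0 :: 'a)"
    and X: "\<And>i. i < s \<Longrightarrow> eigen (X i)" and g: "\<And>i. i < s \<Longrightarrow> Poly_Mapping.keys (g i) \<subseteq> monomials T t"
    and k: "k \<le> card T"
  shows "(card T choose k) * ((2 * card T - k) choose (card T - k)) \<le> s * ((2 * card T + k * t) choose card T)"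
proof -
  let ?l = "card T"
  obtain w where w: "trailing H w" using ex_trailing[OF H(2)] by blast
  then have keysw: "Poly_Mapping.keys w = T" using supp by (auto simp: trailing_def)
  then have wT: "Poly_Mapping.lookup w v > 0" if "v \<in> T" for v
    using that by (auto simp: in_keys_iff)
  define \<A> where "\<A> = {A. A \<subseteq> T \<and> card A = k}"
  have fin\<A>: "finite \<A>" using T by (simp add: \<A>_def)
  have A: "finite A" "A \<subseteq> T" "card A = k" if "A \<in> \<A>" for A
    using that finite_subset[OF _ T] by (auto simp: \<A>_def)
  \<comment> \<open>The shifts avoid A on purpose: then A can be read off from the trailing
    monomial.\<close>
  let ?I = "Sigma \<A> (\<lambda>A. monomials (T - A) ?l)"
  let ?B = "\<Union>i<s. (\<lambda>e. X i * g i ^ (d i - k) * mmonom e) ` monomials T (k * t + ?l)"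
  have "card ?I \<le> card ?B"
  proof (rule card_le_of_trailing)
    show "finite ?I" using fin\<A> A T by (intro finite_SigmaI finite_monomials) auto
    show "finite ?B" using T by (intro finite_UN_I finite_imageI finite_monomials) auto
    show "trailing (mmonom (snd i) * euler_ops (fst i) H) (snd i + (w - indicator_exp (fst i)))" if "i \<in> ?I" for i
    proof -
      have i: "fst i \<in> \<A>" using that by auto
      show ?thesis
        using A(1)[OF i] A(2)[OF i] wT char0 by (intro trailing_mmonom_mult trailing_euler_ops w) blast+
    qed
    show "inj_on (\<lambda>i. snd i + (w - indicator_exp (fst i))) ?I"
    proof (rule inj_onI, clarsimp)
      fix A1 b1 A2 b2
      assume i: "A1 \<in> \<A>" "b1 \<in> monomials (T - A1) ?l" "A2 \<in> \<A>" "b2 \<in> monomials (T - A2) ?l"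
        and eq: "b1 + (w - indicator_exp A1) = b2 + (w - indicator_exp A2)"
      have char: "v \<in> A' \<longleftrightarrow> Poly_Mapping.lookup (b + (w - indicator_exp A')) v < Poly_Mapping.lookup w v"
        if "A' \<in> \<A>" "b \<in> monomials (T - A') ?l" "v \<in> T" for A' b v
      proof -
        have "Poly_Mapping.lookup b v = 0" if "v \<in> A'"
          using \<open>b \<in> monomials (T - A') ?l\<close> that by (auto simp: monomials_def in_keys_iff)
        then show ?thesis using wT[OF that(3)] A(1)[OF that(1)]
          by (auto simp: lookup_add lookup_minus lookup_indicator_exp)
      qed
      have "A1 = A2" using char[OF i(1,2)] char[OF i(3,4)] A(2)[OF i(1)] A(2)[OF i(3)] eq by auto
      with eq show "A1 = A2 \<and> b1 = b2" by simp
    qed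
    show "mmonom (snd i) * euler_ops (fst i) H \<in> mp.span ?B" if i: "i \<in> ?I" for i
    proof -
      obtain A b where Ab: "i = (A, b)" "A \<in> \<A>" "b \<in> monomials (T - A) ?l" using i by auto
      have b: "b \<in> monomials T ?l" using Ab(3) by (auto simp: monomials_def)
      have "mmonom b * foldr euler_op (sorted_list_of_set A) (X j * g j ^ d j) \<in> mp.span ?B" if j: "j < s" for j
      proof -
        obtain Q where Q: "Poly_Mapping.keys Q \<subseteq> monomials T (k * t)"
          "foldr euler_op (sorted_list_of_set A) (X j * g j ^ d j) = X j * g j ^ (d j - k) * Q"
          using foldr_euler_op_form[OF X[OF j] g[OF j], of "sorted_list_of_set A" "d j"] A(1,3)[OF Ab(2)] by auto
        have "Poly_Mapping.keys (Q * mmonom b) \<subseteq> monomials T (k * t + ?l)"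
          using Q(1) b by (intro keys_mult_monomials) auto
        from span_shifts[OF this, of "X j * g j ^ (d j - k)"]
        have "mmonom b * foldr euler_op (sorted_list_of_set A) (X j * g j ^ d j) \<in>
            mp.span ((\<lambda>e. X j * g j ^ (d j - k) * mmonom e) ` monomials T (k * t + ?l))"
          by (simp add: Q(2) mult_ac)
        moreover have "(\<lambda>e. X j * g j ^ (d j - k) * mmonom e) ` monomials T (k * t + ?l) \<subseteq> ?B" using j by blast
        ultimately show ?thesis using mp.span_mono by blast
      qed
      then show ?thesis unfolding Ab(1) H(1) euler_ops_def foldr_euler_op_sum sum_distrib_left fst_conv snd_conv
        by (intro mp.span_sum) auto
    qed
  qed
  also have "card ?B \<le> (\<Sum>i<s. card (monomials T (k * t + ?l)))"
    using T by (intro order_trans[OF card_UN_le] sum_mono card_image_le finite_monomials) auto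
  also have "\<dots> = s * ((2 * ?l + k * t) choose ?l)"
    using card_monomials[OF T, of "k * t + ?l"] by (simp add: mult_2 add_ac)
  finally have "card ?I \<le> s * ((2 * ?l + k * t) choose ?l)" .
  moreover have "card ?I = (?l choose k) * ((2 * ?l - k) choose (?l - k))"
  proof -
    have "card (monomials (T - A') ?l) = (2 * ?l - k) choose (?l - k)" if "A' \<in> \<A>" for A'
    proof -
      have "card (T - A') = ?l - k" using A[OF that] by (simp add: card_Diff_subset)
      moreover have "?l - k + ?l = 2 * ?l - k" using k by simp
      ultimately show ?thesis using card_monomials[of "T - A'" ?l] T by simp
    qed
    then have "card ?I = card \<A> * ((2 * ?l - k) choose (?l - k))"
      using fin\<A> T by (subst card_SigmaI) (auto intro: finite_monomials)
    also have "card \<A> = ?l choose k" using n_subsets[OF T] by (simp add: \<A>_def)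
    finally show ?thesis .
  qed
  ultimately show ?thesis by simp
qed

lemma central_binomial_grow:
  assumes "l \<ge> 1"
  shows "(2 * l + j) choose l \<le> 2 ^ j * ((2 * l) choose l)"
proof (induction j)
  case (Suc j)
  obtain r where r: "l = Suc r" using assms by (cases l) auto
  have "(2 * l + j) choose r \<le> (2 * l + j) choose l"
    by (rule binomial_mono) (use r in auto)
  moreover have "(2 * l + Suc j) choose l = ((2 * l + j) choose r) + ((2 * l + j) choose l)"
    by (simp add: r)
  ultimately show ?case using Suc by simp
qed simp

lemma central_binomial_shrink:
  "2 * i \<le> l \<Longrightarrow> (2 * l) choose l \<le> 4 ^ i * ((2 * l - i) choose (l - i))"
proof (induction i)
  case (Suc i)
  define a m where "a = l - Suc i" and "m = 2 * l - Suc i"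
  have am: "l - i = Suc a" "2 * l - i = Suc m" using Suc.prems by (auto simp: a_def m_def)
  have "Suc a * (Suc m choose Suc a) = Suc m * (m choose a)" by (rule Suc_times_binomial)
  also have "\<dots> \<le> (4 * Suc a) * (m choose a)"
    using Suc.prems by (intro mult_right_mono) (auto simp: a_def m_def)
  finally have "Suc a * (Suc m choose Suc a) \<le> Suc a * (4 * (m choose a))" by (simp only: mult_ac)
  then have "Suc m choose Suc a \<le> 4 * (m choose a)" by (simp only: mult_le_cancel1 zero_less_Suc simp_thms)
  then have "4 ^ i * (Suc m choose Suc a) \<le> 4 ^ i * (4 * (m choose a))" by (rule mult_left_mono) simp
  moreover have "(2 * l) choose l \<le> 4 ^ i * (Suc m choose Suc a)" using Suc unfolding am by simp
  ultimately show ?case unfolding a_def m_def power_Suc by (simp only: mult_ac)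
qed simp

lemma shifted_partials_numbers:
  assumes k: "k \<ge> 1" and l: "k * 2 ^ (t + 3) \<le> l" and s: "s < 2 ^ k"
  shows "s * ((2 * l + k * t) choose l) < (l choose k) * ((2 * l - k) choose (l - k))"
proof -
  let ?C = "(2 * l) choose l"
  have "k * 1 \<le> k * 2 ^ (t + 3)" "k * 2 \<le> k * 2 ^ (t + 3)" by (auto simp: power_add)
  then have kl: "k \<le> l" "2 * k \<le> l" using l by linarith+
  have "(2 ^ (t + 3)) ^ k \<le> (real l / real k) ^ k"
  proof (rule power_mono)
    have "real k * 2 ^ (t + 3) \<le> real l" using of_nat_mono[OF l, where 'a = real] by simp
    then show "2 ^ (t + 3) \<le> real l / real k" using k by (simp add: le_divide_eq mult.commute)
  qed simp
  also have "\<dots> \<le> real (l choose k)" using binomial_ge_n_over_k_pow_k[OF kl(1), where 'a = real] .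
  finally have "real ((2 ^ (t + 3)) ^ k) \<le> real (l choose k)" by simp
  then have lk: "(2 ^ (t + 3)) ^ k \<le> l choose k" by (simp only: of_nat_le_iff)
  have "s * ((2 * l + k * t) choose l) \<le> s * (2 ^ (k * t) * ?C)"
    using central_binomial_grow[of l "k * t"] k kl by (intro mult_left_mono) auto
  also have "\<dots> < 2 ^ k * (2 ^ (k * t) * ?C)"
    using s by (intro mult_strict_right_mono) (simp_all add: zero_less_binomial)
  also have "\<dots> \<le> 2 ^ k * (2 ^ (k * t) * (4 ^ k * ((2 * l - k) choose (l - k))))"
    using central_binomial_shrink[OF kl(2)] by (intro mult_left_mono) auto
  also have "\<dots> = (2 ^ (t + 3)) ^ k * ((2 * l - k) choose (l - k))"
  proof -
    have "(2::nat) ^ k * (2 ^ (k * t) * 4 ^ k) = (2 ^ (t + 3)) ^ k"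
    proof -
      have "(4::nat) ^ k = 2 ^ (2 * k)" by (simp add: power_mult)
      moreover have "k + (k * t + 2 * k) = (t + 3) * k" by algebra
      ultimately show ?thesis by (metis power_add power_mult)
    qed
    then show ?thesis by (simp only: mult.assoc[symmetric])
  qed
  also have "\<dots> \<le> (l choose k) * ((2 * l - k) choose (l - k))"
    using lk by (intro mult_right_mono) auto
  finally show ?thesis .
qed

section \<open>Characteristic zero\<close>

lemma keys_shift_sub_monomials:
  fixes f :: "'a::comm_ring_1 mpoly"
  assumes "tdeg f \<le> t"
  shows "Poly_Mapping.keys (msubst f (shift_sub T)) \<subseteq> monomials T t"
proof
  fix m assume m: "m \<in> Poly_Mapping.keys (msubst f (shift_sub T))"
  from keys_shift_sub_le[OF m] obtain m' where "m' \<in> Poly_Mapping.keys f" "exp_size m \<le> exp_size m'"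
    using exp_size_mono by blast
  then have "exp_size m \<le> t" using assms by (auto simp: tdeg_le_iff)
  with mvars_shift_sub[of f T] m show "m \<in> monomials T t" unfolding mvars_subset_iff monomials_def by blast
qed

lemma mvars_sws_formula:
  assumes "sws_formula N t s F"
  shows "mvars F \<subseteq> {..<N}"
proof -
  obtain a d Fs where F: "F = (\<Sum>i<s. mmonom (a i) * Fs i ^ d i)"
    and vars: "\<And>i. i < s \<Longrightarrow> Poly_Mapping.keys (a i) \<subseteq> {..<N} \<and> mvars (Fs i) \<subseteq> {..<N}"
    using assms unfolding sws_formula_def by blast
  show ?thesis unfolding F
    by (intro mvars_sum mvars_mult mvars_power) (use vars in simp_all)
qed

lemma sparse_gen_hits_char_0:
  fixes F :: "'a::field mpoly"
  assumes F: "sws_formula (2 ^ n) t s F" "F \<noteq> 0" and char0: "CHAR('a) = 0"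
    and k: "k \<ge> 1" "s < 2 ^ k"
  shows "msubst F (sparse_gen n (k * 2 ^ (t + 3))) \<noteq> 0"
proof -
  note vars = mvars_sws_formula[OF F(1)]
  from F(1) obtain a d Fs where
    Fs: "\<And>i. i < s \<Longrightarrow> tdeg (Fs i) \<le> t" and F_eq: "F = (\<Sum>i<s. mmonom (a i) * Fs i ^ d i)"
    unfolding sws_formula_def by blast
  obtain T where T: "T \<subseteq> {..<2 ^ n}" "msubst F (shift_sub T) \<noteq> 0"
    "\<And>m. m \<in> Poly_Mapping.keys (msubst F (shift_sub T)) \<Longrightarrow> Poly_Mapping.keys m = T"
    using ex_minimal_support[OF F(2) vars] by auto
  have finT: "finite T" using T(1) finite_subset by blast
  have "card T \<le> k * 2 ^ (t + 3)"
  proof (rule ccontr)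
    assume "\<not> ?thesis"
    then have large: "k * 2 ^ (t + 3) \<le> card T" by simp
    have "k * 1 \<le> k * 2 ^ (t + 3)" by (intro mult_left_mono) auto
    with large have "k \<le> card T" by linarith
    have H: "msubst F (shift_sub T) = (\<Sum>i<s. mpow (shift_sub T) (a i) * msubst (Fs i) (shift_sub T) ^ d i)"
      by (simp add: F_eq msubst_sum msubst_mult msubst_mmonom msubst_power)
    have "(card T choose k) * ((2 * card T - k) choose (card T - k)) \<le> s * ((2 * card T + k * t) choose card T)"
      by (rule shifted_partials_bound[OF H T(2) finT T(3)])
        (use char0 \<open>k \<le> card T\<close> Fs in \<open>auto simp: of_nat_eq_0_iff_char_dvd eigen_mpow_shift_sub dest: subsetD[OF keys_shift_sub_monomials]\<close>)
    with shifted_partials_numbers[OF k(1) large k(2)] show False by linarith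
  qed
  moreover obtain w where "w \<in> Poly_Mapping.keys (msubst F (shift_sub T))"
    using T(2) by (metis ex_in_conv keys_eq_empty)
  ultimately obtain \<nu> where "\<nu> \<in> Poly_Mapping.keys (msubst F (sparse_gen n (k * 2 ^ (t + 3))))"
    using sparse_gen_hits[OF T(1) _ vars] by blast
  then show ?thesis by auto
qed

section \<open>Positive characteristic\<close>

definition exp_scale :: "nat \<Rightarrow> (nat \<Rightarrow>\<^sub>0 nat) \<Rightarrow> (nat \<Rightarrow>\<^sub>0 nat)" where
  "exp_scale p = Poly_Mapping.map ((*) p)"

definition exp_div :: "nat \<Rightarrow> (nat \<Rightarrow>\<^sub>0 nat) \<Rightarrow> (nat \<Rightarrow>\<^sub>0 nat)" where
  "exp_div p = Poly_Mapping.map (\<lambda>x. x div p)"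

definition exp_mod :: "nat \<Rightarrow> (nat \<Rightarrow>\<^sub>0 nat) \<Rightarrow> (nat \<Rightarrow>\<^sub>0 nat)" where
  "exp_mod p = Poly_Mapping.map (\<lambda>x. x mod p)"

lemma lookup_exp_scale [simp]: "Poly_Mapping.lookup (exp_scale p m) x = p * Poly_Mapping.lookup m x"
  by (simp add: exp_scale_def Poly_Mapping.map.rep_eq when_def)

lemma lookup_exp_div [simp]: "Poly_Mapping.lookup (exp_div p m) x = Poly_Mapping.lookup m x div p"
  by (simp add: exp_div_def Poly_Mapping.map.rep_eq when_def)

lemma lookup_exp_mod [simp]: "Poly_Mapping.lookup (exp_mod p m) x = Poly_Mapping.lookup m x mod p"
  by (simp add: exp_mod_def Poly_Mapping.map.rep_eq when_def)

lemma exp_mod_exp_div: "exp_mod p m + exp_scale p (exp_div p m) = m"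
  by (rule poly_mapping_eqI) (simp add: lookup_add)

lemma exp_scale_0 [simp]: "exp_scale p 0 = 0"
  by (rule poly_mapping_eqI) simp

lemma keys_exp_scale: "Poly_Mapping.keys (exp_scale p m) \<subseteq> Poly_Mapping.keys m"
  by (auto simp: in_keys_iff)

lemma exp_size_exp_scale: "exp_size (exp_scale p m) = p * exp_size m"
  unfolding exp_size_superset[OF finite_keys[of m] keys_exp_scale] by (simp add: exp_size_def sum_distrib_left)

lemma mpow_exp_scale: "mpow G (exp_scale p m) = mpow G m ^ p"
  unfolding mpow_superset[OF finite_keys[of m] keys_exp_scale]
  unfolding mpow_def prod_power_distrib by (simp add: power_mult mult.commute[of p])

lemma mpow_power: "mpow (\<lambda>j. G j ^ p) m = mpow G m ^ p"
  unfolding mpow_def prod_power_distrib by (simp add: mult.commute flip: power_mult)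

lemma mmonom_power: "mmonom m ^ p = (mmonom (exp_scale p m) :: 'a::comm_semiring_1 mpoly)"
  by (simp add: mpow_exp_scale flip: mpow_mvar)

lemma CHAR_mpoly: "CHAR('a mpoly) = CHAR('a::comm_semiring_1)"
proof (rule CHAR_eqI)
  have iff: "of_nat x = (0 :: 'a mpoly) \<longleftrightarrow> of_nat x = (0 :: 'a)" for x
    unfolding of_nat_mpoly by (metis lookup_mconst_mult mconst_0 mult_1_right lookup_one_zero lookup_zero)
  show "of_nat CHAR('a) = (0 :: 'a mpoly)" by (simp add: iff)
  show "CHAR('a) dvd x" if "of_nat x = (0 :: 'a mpoly)" for x
    using that by (simp add: iff of_nat_eq_0_iff_char_dvd)
qed

definition frob :: "nat \<Rightarrow> 'a mpoly \<Rightarrow> 'a::comm_semiring_1 mpoly" where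
  "frob p q = msubst q (\<lambda>j. mvar j ^ p)"

lemma frob_mmonom: "frob p (mmonom m) = mmonom m ^ p"
  by (simp add: frob_def msubst_mmonom mpow_power mpow_mvar)

lemma sparse_gen_power:
  assumes "prime CHAR('a::comm_semiring_1)" "p = CHAR('a)"
  shows "sparse_gen n k j ^ p = frob p (sparse_gen n k j :: 'a mpoly)"
proof -
  have pr: "prime CHAR('a mpoly)" "p = CHAR('a mpoly)" using assms by (simp_all add: CHAR_mpoly)
  show ?thesis
    unfolding sparse_gen_def freshmans_dream[OF pr] freshmans_dream_sum[OF pr]
    by (simp add: frob_def msubst_add msubst_sum frob_mmonom[unfolded frob_def])
qed

definition residue_part :: "nat \<Rightarrow> 'a mpoly \<Rightarrow> (nat \<Rightarrow>\<^sub>0 nat) \<Rightarrow> 'a::comm_semiring_1 mpoly" where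
  "residue_part p F b = (\<Sum>m\<in>{m\<in>Poly_Mapping.keys F. exp_mod p m = b}. mconst (Poly_Mapping.lookup F m) * mmonom (exp_div p m))"

lemma lookup_residue_part:
  assumes "m \<in> Poly_Mapping.keys F"
  shows "Poly_Mapping.lookup (residue_part p F (exp_mod p m)) (exp_div p m) = Poly_Mapping.lookup F m"
proof -
  have "Poly_Mapping.lookup (residue_part p F (exp_mod p m)) (exp_div p m) =
      (\<Sum>m'\<in>{m'\<in>Poly_Mapping.keys F. exp_mod p m' = exp_mod p m}. if m' = m then Poly_Mapping.lookup F m else 0)"
    unfolding residue_part_def lookup_sum lookup_mconst_mult lookup_mmonom
  proof (intro sum.cong refl)
    fix m' assume "m' \<in> {m'\<in>Poly_Mapping.keys F. exp_mod p m' = exp_mod p m}"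
    then have "exp_div p m = exp_div p m' \<longleftrightarrow> m' = m" by (metis (mono_tags, lifting) mem_Collect_eq exp_mod_exp_div)
    then show "Poly_Mapping.lookup F m' * (if exp_div p m = exp_div p m' then 1 else 0) = (if m' = m then Poly_Mapping.lookup F m else 0)"
      by simp
  qed
  then show ?thesis using assms by (simp add: sum.delta)
qed

lemma keys_compE:
  assumes "w \<in> Poly_Mapping.keys (residue_part p F b)"
  obtains m where "m \<in> Poly_Mapping.keys F" "exp_mod p m = b" "w = exp_div p m"
proof -
  from assms obtain m where m: "m \<in> {m\<in>Poly_Mapping.keys F. exp_mod p m = b}"
    "w \<in> Poly_Mapping.keys (mconst (Poly_Mapping.lookup F m) * mmonom (exp_div p m))"
    unfolding residue_part_def by (rule keys_sumE)
  then have "w = exp_div p m" using keys_mconst_mult_subset by fastforce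
  with m(1) that show ?thesis by blast
qed

lemma msubst_sparse_gen_decomp:
  assumes "prime CHAR('a::comm_semiring_1)" "p = CHAR('a)"
  shows "msubst F (sparse_gen n k :: nat \<Rightarrow> 'a mpoly) =
    (\<Sum>b\<in>exp_mod p ` Poly_Mapping.keys F. mpow (sparse_gen n k) b * frob p (msubst (residue_part p F b) (sparse_gen n k)))"
proof -
  let ?G = "sparse_gen n k :: nat \<Rightarrow> 'a mpoly"
  have pw: "mpow ?G m = mpow ?G (exp_mod p m) * frob p (mpow ?G (exp_div p m))" for m
  proof -
    have "mpow ?G m = mpow ?G (exp_mod p m) * mpow ?G (exp_div p m) ^ p"
      unfolding mpow_exp_scale[symmetric] mpow_add[symmetric] exp_mod_exp_div ..
    also have "mpow ?G (exp_div p m) ^ p = frob p (mpow ?G (exp_div p m))"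
      unfolding mpow_power[symmetric] sparse_gen_power[OF assms] by (simp add: frob_def msubst_mpow)
    finally show ?thesis .
  qed
  have "msubst F ?G = (\<Sum>b\<in>exp_mod p ` Poly_Mapping.keys F. \<Sum>m\<in>{m\<in>Poly_Mapping.keys F. exp_mod p m = b}.
      mconst (Poly_Mapping.lookup F m) * (mpow ?G (exp_mod p m) * frob p (mpow ?G (exp_div p m))))"
    unfolding pw[symmetric] msubst_lin_ext[of F] lin_ext_def by (rule sum.image_gen) simp
  also have "\<dots> = (\<Sum>b\<in>exp_mod p ` Poly_Mapping.keys F. mpow ?G b * frob p (msubst (residue_part p F b) ?G))"
    by (intro sum.cong refl)
      (simp add: residue_part_def frob_def msubst_sum msubst_mconst_mult msubst_mmonom sum_distrib_left mult_ac)
  finally show ?thesis .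
qed

lemma lookup_mult_frob:
  fixes R Q :: "'a::comm_semiring_1 mpoly"
  assumes min: "\<And>\<mu>'. \<mu>' \<in> Poly_Mapping.keys Q \<Longrightarrow> exp_size \<mu> \<le> exp_size \<mu>'"
    and \<nu>: "\<And>x. Poly_Mapping.lookup \<nu> x < p"
  shows "Poly_Mapping.lookup (R * frob p Q) (exp_scale p \<mu> + \<nu>) = Poly_Mapping.lookup Q \<mu> * Poly_Mapping.lookup R \<nu>"
proof -
  have "R * frob p Q = (\<Sum>\<mu>'\<in>Poly_Mapping.keys Q. mconst (Poly_Mapping.lookup Q \<mu>') * (mmonom (exp_scale p \<mu>') * R))"
    unfolding frob_def msubst_lin_ext lin_ext_def
    by (simp add: sum_distrib_left mpow_power mpow_mvar mmonom_power mult_ac)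
  also have "Poly_Mapping.lookup \<dots> (exp_scale p \<mu> + \<nu>) =
      (\<Sum>\<mu>'\<in>Poly_Mapping.keys Q. if \<mu>' = \<mu> then Poly_Mapping.lookup Q \<mu> * Poly_Mapping.lookup R \<nu> else 0)"
    unfolding lookup_sum lookup_mconst_mult
  proof (intro sum.cong refl)
    fix \<mu>' assume \<mu>': "\<mu>' \<in> Poly_Mapping.keys Q"
    show "Poly_Mapping.lookup Q \<mu>' * Poly_Mapping.lookup (mmonom (exp_scale p \<mu>') * R) (exp_scale p \<mu> + \<nu>) =
        (if \<mu>' = \<mu> then Poly_Mapping.lookup Q \<mu> * Poly_Mapping.lookup R \<nu> else 0)"
    proof (cases "\<mu>' = \<mu>")
      case False
      have "Poly_Mapping.lookup (mmonom (exp_scale p \<mu>') * R) (exp_scale p \<mu> + \<nu>) = 0"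
      proof (rule lookup_mmonom_mult_eq_0, rule notI)
        fix m assume eq: "exp_scale p \<mu> + \<nu> = exp_scale p \<mu>' + m"
        have le: "Poly_Mapping.lookup \<mu>' x \<le> Poly_Mapping.lookup \<mu> x" for x
        proof -
          have "p * Poly_Mapping.lookup \<mu> x + Poly_Mapping.lookup \<nu> x = p * Poly_Mapping.lookup \<mu>' x + Poly_Mapping.lookup m x"
            using arg_cong[OF eq, of "\<lambda>q. Poly_Mapping.lookup q x"] by (simp add: lookup_add)
          then have "p * Poly_Mapping.lookup \<mu>' x < p * (Poly_Mapping.lookup \<mu> x + 1)"
            using \<nu>[of x] by (simp add: algebra_simps)
          then have "Poly_Mapping.lookup \<mu>' x < Poly_Mapping.lookup \<mu> x + 1" by (simp only: mult_less_cancel1)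
          then show ?thesis by simp
        qed
        have "\<mu> = \<mu>' + (\<mu> - \<mu>')"
          by (rule poly_mapping_eqI) (use le in \<open>simp add: lookup_add lookup_minus\<close>)
        then have "exp_size \<mu> = exp_size \<mu>' + exp_size (\<mu> - \<mu>')" by (metis exp_size_add)
        with min[OF \<mu>'] have "\<mu> - \<mu>' = 0" by (simp add: exp_size_eq_0_iff)
        with \<open>\<mu> = \<mu>' + (\<mu> - \<mu>')\<close> False show False by simp
      qed
      with False show ?thesis by simp
    qed (simp add: lookup_mmonom_mult_add)
  qed
  also have "\<dots> = Poly_Mapping.lookup Q \<mu> * Poly_Mapping.lookup R \<nu>"
    by (auto simp: sum.delta in_keys_iff)
  finally show ?thesis .
qed

lemma sparse_gen_hits_step:
  fixes F :: "'a::field mpoly"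
  assumes p: "prime CHAR('a)" "p = CHAR('a)" and vars: "mvars F \<subseteq> {..<2 ^ n}"
    and sparse: "card (exp_mod p ` Poly_Mapping.keys F) \<le> 2 ^ k"
    and hit: "b0 \<in> exp_mod p ` Poly_Mapping.keys F" "msubst (residue_part p F b0) (sparse_gen n k) \<noteq> 0"
  shows "msubst F (sparse_gen n k) \<noteq> 0"
proof -
  let ?G = "sparse_gen n k :: nat \<Rightarrow> 'a mpoly"
  let ?B = "exp_mod p ` Poly_Mapping.keys F"
  let ?Q = "\<lambda>b. msubst (residue_part p F b) ?G"
  have p0: "p > 0" using p prime_gt_0_nat by blast
  define U where "U = (\<Union>b\<in>?B. Poly_Mapping.keys (?Q b))"
  have "Poly_Mapping.keys (?Q b0) \<noteq> {}" using hit(2) by simp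
  then have "\<exists>\<mu>. \<mu> \<in> U" using hit(1) unfolding U_def by blast
  then obtain \<mu> where \<mu>: "\<mu> \<in> U" "\<And>\<mu>'. \<mu>' \<in> U \<Longrightarrow> exp_size \<mu> \<le> exp_size \<mu>'"
    using arg_min_nat_lemma[of "\<lambda>\<mu>. \<mu> \<in> U" _ exp_size] by blast
  define \<Phi> where "\<Phi> = (\<Sum>b\<in>?B. Poly_Mapping.single b (Poly_Mapping.lookup (?Q b) \<mu>))"
  have look\<Phi>: "Poly_Mapping.lookup \<Phi> b = (if b \<in> ?B then Poly_Mapping.lookup (?Q b) \<mu> else 0)" for b
    by (simp add: \<Phi>_def lookup_sum lookup_single when_def sum.delta)
  have keys\<Phi>: "Poly_Mapping.keys \<Phi> \<subseteq> ?B"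
    by (auto simp: in_keys_iff look\<Phi> split: if_splits)
  have "\<Phi> \<noteq> 0"
  proof -
    obtain b where b: "b \<in> ?B" "\<mu> \<in> Poly_Mapping.keys (?Q b)" using \<mu>(1) unfolding U_def by blast
    then have "Poly_Mapping.lookup \<Phi> b \<noteq> 0" by (simp add: look\<Phi> in_keys_iff)
    then show ?thesis by auto
  qed
  have small: "Poly_Mapping.lookup b v < p" if "b \<in> ?B" for b v
    using that p0 by auto
  have vars\<Phi>: "mvars \<Phi> \<subseteq> {..<2 ^ n}"
    unfolding mvars_subset_iff
  proof
    fix b assume "b \<in> Poly_Mapping.keys \<Phi>"
    with keys\<Phi> obtain m where m: "m \<in> Poly_Mapping.keys F" "b = exp_mod p m" by blast
    then have "Poly_Mapping.keys b \<subseteq> Poly_Mapping.keys m" by (auto simp: in_keys_iff intro!: Nat.gr0I)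
    with m(1) vars show "Poly_Mapping.keys b \<subseteq> {..<2 ^ n}" unfolding mvars_subset_iff by blast
  qed
  obtain T where T: "T \<subseteq> {..<2 ^ n}" "msubst \<Phi> (shift_sub T) \<noteq> 0"
    "\<And>m. m \<in> Poly_Mapping.keys (msubst \<Phi> (shift_sub T)) \<Longrightarrow> Poly_Mapping.keys m = T"
    using ex_minimal_support[OF \<open>\<Phi> \<noteq> 0\<close> vars\<Phi>] by auto
  have finT: "finite T" using T(1) finite_subset by blast
  have small_H: "Poly_Mapping.lookup m v < p" if "m \<in> Poly_Mapping.keys (msubst \<Phi> (shift_sub T))" for m v
    using keys_shift_sub_le[OF that] keys\<Phi> small by (meson le_less_trans subsetD)
  have "2 ^ card T \<le> card (Poly_Mapping.keys \<Phi>)"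
  proof (rule sparse_support_bound[OF T(2) finT])
    fix m v assume m: "m \<in> Poly_Mapping.keys (msubst \<Phi> (shift_sub T))" and "v \<in> T"
    then have "Poly_Mapping.lookup m v > 0" using T(3)[OF m] by (auto simp: in_keys_iff)
    then show "of_nat (Poly_Mapping.lookup m v) \<noteq> (0 :: 'a)"
      using small_H[OF m, of v] p(2) by (auto simp: of_nat_eq_0_iff_char_dvd dest: dvd_imp_le)
  qed
  also have "\<dots> \<le> card ?B" by (rule card_mono[OF _ keys\<Phi>]) simp
  also have "\<dots> \<le> 2 ^ k" by (rule sparse)
  finally have "card T \<le> k" by simp
  moreover obtain w where w: "w \<in> Poly_Mapping.keys (msubst \<Phi> (shift_sub T))"
    using T(2) by (metis ex_in_conv keys_eq_empty)
  ultimately obtain \<nu> where \<nu>: "\<nu> \<in> Poly_Mapping.keys (msubst \<Phi> ?G)"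
    "\<And>x. Poly_Mapping.lookup \<nu> x = 0 \<or> (\<exists>v. Poly_Mapping.lookup \<nu> x = Poly_Mapping.lookup w v)"
    using sparse_gen_hits[OF T(1) _ vars\<Phi>] by blast
  have \<nu>p: "Poly_Mapping.lookup \<nu> x < p" for x
    using \<nu>(2)[of x] small_H[OF w] p0 by auto
  have "Poly_Mapping.lookup (msubst F ?G) (exp_scale p \<mu> + \<nu>) =
      (\<Sum>b\<in>?B. Poly_Mapping.lookup (?Q b) \<mu> * Poly_Mapping.lookup (mpow ?G b) \<nu>)"
    unfolding arg_cong[OF msubst_sparse_gen_decomp[OF p, of F n k], of "\<lambda>q. Poly_Mapping.lookup q (exp_scale p \<mu> + \<nu>)"] lookup_sum
    by (intro sum.cong refl lookup_mult_frob \<nu>p \<mu>(2)) (auto simp: U_def)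
  also have "\<dots> = Poly_Mapping.lookup (msubst \<Phi> ?G) \<nu>"
    unfolding msubst_lin_ext[of \<Phi>] lin_ext_superset[OF finite_imageI[OF finite_keys] keys\<Phi>]
      lookup_sum lookup_mconst_mult
    by (intro sum.cong refl) (simp add: look\<Phi>)
  also have "\<dots> \<noteq> 0" using \<nu>(1) by (simp add: in_keys_iff)
  finally show ?thesis by auto
qed

text \<open>Exponents all of whose base-\<open>p\<close> digit vectors, in a redundant expansion, have size at most
  \<open>D\<close>: in characteristic \<open>p\<close> these are all that occur in a power of a polynomial of degree \<open>D / (p - 1)\<close>.\<close>

inductive_set digits :: "nat \<Rightarrow> nat \<Rightarrow> (nat \<Rightarrow>\<^sub>0 nat) set" for D p where
  zero: "0 \<in> digits D p"
| step: "exp_size e \<le> D \<Longrightarrow> v \<in> digits D p \<Longrightarrow> e + exp_scale p v \<in> digits D p"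

lemma digits_unfold:
  assumes "v \<in> digits D p"
  obtains e v' where "v = e + exp_scale p v'" "exp_size e \<le> D" "v' \<in> digits D p"
  using assms
proof cases
  case zero
  then show ?thesis using that[of 0 0] digits.zero by simp
qed (use that in blast)

lemma keys_power_digits:
  fixes f :: "'a::comm_semiring_1 mpoly"
  assumes p: "prime CHAR('a)" "p = CHAR('a)" and f: "\<And>m. m \<in> Poly_Mapping.keys f \<Longrightarrow> exp_size m \<le> t"
  shows "Poly_Mapping.keys (f ^ d) \<subseteq> digits ((p - 1) * t) p"
proof (induction d rule: less_induct)
  case (less d)
  have low: "exp_size m \<le> e * t" if "m \<in> Poly_Mapping.keys (f ^ e)" for m e
    using that
  proof (induction e arbitrary: m)
    case (Suc e)
    then obtain a b where "m = a + b" "a \<in> Poly_Mapping.keys f" "b \<in> Poly_Mapping.keys (f ^ e)"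
      by (auto elim: keys_multE)
    with f[of a] Suc.IH[of b] show ?case by (simp add: exp_size_add)
  qed simp
  have pr: "prime CHAR('a mpoly)" "p = CHAR('a mpoly)" using p by (simp_all add: CHAR_mpoly)
  have p1: "p > 1" using p prime_gt_1_nat by blast
  show ?case
  proof (cases "d = 0")
    case True
    then show ?thesis by (simp add: digits.zero)
  next
    case False
    let ?g = "f ^ (d div p)"
    have "f ^ d = f ^ (d mod p) * ?g ^ p"
      by (simp flip: power_mult power_add)
    show ?thesis
    proof
      fix m assume "m \<in> Poly_Mapping.keys (f ^ d)"
      then obtain a b where ab: "m = a + b" "a \<in> Poly_Mapping.keys (f ^ (d mod p))" "b \<in> Poly_Mapping.keys (?g ^ p)"
        unfolding \<open>f ^ d = _\<close> by (rule keys_multE)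
      have "?g ^ p = (\<Sum>m\<in>Poly_Mapping.keys ?g. mconst (Poly_Mapping.lookup ?g m ^ p) * mmonom (exp_scale p m))"
        by (subst mpoly_expand[of ?g], subst freshmans_dream_sum[OF pr])
          (simp add: power_mult_distrib mconst_power mmonom_power)
      with ab(3) have "b \<in> Poly_Mapping.keys (\<Sum>m\<in>Poly_Mapping.keys ?g. mconst (Poly_Mapping.lookup ?g m ^ p) * mmonom (exp_scale p m))"
        by simp
      then obtain v where v: "v \<in> Poly_Mapping.keys ?g" "b \<in> Poly_Mapping.keys (mconst (Poly_Mapping.lookup ?g v ^ p) * mmonom (exp_scale p v))"
        by (rule keys_sumE)
      then have "b = exp_scale p v" using keys_mconst_mult_subset by fastforce
      moreover have "v \<in> digits ((p - 1) * t) p"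
        using v(1) less[of "d div p"] False p1 by auto
      moreover have "exp_size a \<le> (p - 1) * t"
      proof -
        have "d mod p \<le> p - 1" using p1 by (metis One_nat_def Suc_pred less_Suc_eq_le mod_less_divisor zero_less_one order.strict_trans)
        then have "d mod p * t \<le> (p - 1) * t" by (rule mult_right_mono) simp
        with low[OF ab(2)] show ?thesis by linarith
      qed
      ultimately show "m \<in> digits ((p - 1) * t) p" using digits.step[of a "(p - 1) * t" v p] by (simp add: ab(1))
    qed
  qed
qed

definition digit_class :: "nat \<Rightarrow> nat \<Rightarrow> (nat \<Rightarrow>\<^sub>0 nat) set \<Rightarrow> 'a::zero mpoly \<Rightarrow> bool" where
  "digit_class p t A F \<longleftrightarrow> (\<forall>m\<in>Poly_Mapping.keys F. \<exists>a\<in>A. \<exists>e v.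
     m = a + e + v \<and> exp_size e \<le> t \<and> v \<in> digits ((p - 1) * t) p)"

lemma digit_classE:
  assumes "digit_class p t A F" "m \<in> Poly_Mapping.keys F" "p > 0"
  obtains a e v where "a \<in> A" "m = a + e + exp_scale p v" "exp_size e \<le> p * t" "v \<in> digits ((p - 1) * t) p"
proof -
  obtain a e v where *: "a \<in> A" "m = a + e + v" "exp_size e \<le> t" "v \<in> digits ((p - 1) * t) p"
    using assms(1,2) unfolding digit_class_def by blast
  obtain e' v' where **: "v = e' + exp_scale p v'" "exp_size e' \<le> (p - 1) * t" "v' \<in> digits ((p - 1) * t) p"
    using *(4) by (rule digits_unfold)
  have "t + (p - 1) * t = p * t" using assms(3) by (cases p) auto
  then show ?thesis using * ** by (intro that[of a "e + e'" v']) (auto simp: exp_size_add add_ac)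
qed

lemma card_exp_mod_digit_class:
  assumes F: "digit_class p t A F" and A: "finite A" and vars: "mvars F \<subseteq> V" "finite V" and p: "p > 0"
  shows "card (exp_mod p ` Poly_Mapping.keys F) \<le> card A * ((card V + p * t) choose card V)"
proof -
  have "exp_mod p ` Poly_Mapping.keys F \<subseteq> (\<lambda>(a, e). exp_mod p (a + e)) ` (A \<times> monomials V (p * t))"
  proof
    fix b assume "b \<in> exp_mod p ` Poly_Mapping.keys F"
    then obtain m where m: "m \<in> Poly_Mapping.keys F" "b = exp_mod p m" by blast
    obtain a e v where *: "a \<in> A" "m = a + e + exp_scale p v" "exp_size e \<le> p * t"
      using digit_classE[OF F m(1) p] by metis
    have "b = exp_mod p (a + e)"
      unfolding m(2) *(2) by (rule poly_mapping_eqI) (simp add: lookup_add)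
    moreover have "Poly_Mapping.keys e \<subseteq> Poly_Mapping.keys m"
      unfolding *(2) by (auto simp: in_keys_iff lookup_add)
    then have "e \<in> monomials V (p * t)" using m(1) vars(1) *(3) unfolding mvars_subset_iff monomials_def by blast
    ultimately show "b \<in> (\<lambda>(a, e). exp_mod p (a + e)) ` (A \<times> monomials V (p * t))" using *(1) by force
  qed
  then have "card (exp_mod p ` Poly_Mapping.keys F) \<le> card (A \<times> monomials V (p * t))"
    by (rule surj_card_le[rotated]) (simp add: A finite_monomials[OF vars(2)])
  then show ?thesis using card_monomials[OF vars(2)] by (simp add: card_cartesian_product)
qed

lemma digit_class_residue_part:
  assumes F: "digit_class p t A F" and p: "p > 0"
  shows "digit_class p t ((\<lambda>a. Poly_Mapping.map (\<lambda>x. (x + (p - 1)) div p) (a - b)) ` A) (residue_part p F b)"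
  unfolding digit_class_def
proof
  fix w assume "w \<in> Poly_Mapping.keys (residue_part p F b)"
  then obtain m where m: "m \<in> Poly_Mapping.keys F" "exp_mod p m = b" "w = exp_div p m" by (rule keys_compE)
  then have bw: "m = b + exp_scale p w" using exp_mod_exp_div[of p m] by simp
  have b: "Poly_Mapping.lookup b x < p" for x using m(2) p by auto
  obtain a e v where *: "a \<in> A" "m = a + e + exp_scale p v" "exp_size e \<le> p * t" "v \<in> digits ((p - 1) * t) p"
    using F m(1) p by (rule digit_classE)
  define a' where "a' = Poly_Mapping.map (\<lambda>x. (x + (p - 1)) div p) (a - b)"
  have a': "Poly_Mapping.lookup a' x = (Poly_Mapping.lookup a x - Poly_Mapping.lookup b x + (p - 1)) div p" for x
    using p by (simp add: a'_def Poly_Mapping.map.rep_eq when_def lookup_minus)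
  have key: "Poly_Mapping.lookup a' x + Poly_Mapping.lookup v x \<le> Poly_Mapping.lookup w x \<and>
      p * (Poly_Mapping.lookup w x - Poly_Mapping.lookup a' x - Poly_Mapping.lookup v x) \<le> Poly_Mapping.lookup e x" for x
  proof -
    let ?a = "Poly_Mapping.lookup a x" and ?b = "Poly_Mapping.lookup b x" and ?c = "Poly_Mapping.lookup a' x"
      and ?e = "Poly_Mapping.lookup e x" and ?v = "Poly_Mapping.lookup v x" and ?w = "Poly_Mapping.lookup w x"
    have eq: "?b + p * ?w = ?a + ?e + p * ?v"
      using arg_cong[OF bw[symmetric, unfolded *(2)], of "\<lambda>q. Poly_Mapping.lookup q x"] by (simp add: lookup_add)
    have "p * ?c + (?a - ?b + (p - 1)) mod p = ?a - ?b + (p - 1)"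
      unfolding a' by simp
    moreover have "(?a - ?b + (p - 1)) mod p < p" using p by simp
    ultimately have c: "p * ?c \<le> ?a - ?b + (p - 1)" "?a - ?b \<le> p * ?c" using p by linarith+
    have "p * (?c + ?v) < p * (?w + 1)"
    proof (cases "?b \<le> ?a")
      case True
      then show ?thesis using c(1) eq p by (simp add: algebra_simps)
    next
      case False
      then have "?c = 0" using p by (simp add: a')
      then show ?thesis using eq b[of x] by (simp add: algebra_simps)
    qed
    then have "?c + ?v < ?w + 1" by (simp only: mult_less_cancel1)
    then have le: "?c + ?v \<le> ?w" by simp
    then have "p * (?w - ?c - ?v) + p * ?c + p * ?v = p * ?w"
      by (simp flip: add_mult_distrib2)
    with eq c(2) have "p * (?w - ?c - ?v) \<le> ?e" by linarith
    with le show ?thesis by simp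
  qed
  let ?e = "w - a' - v"
  have "w = a' + ?e + v"
  proof (rule poly_mapping_eqI)
    fix x
    show "Poly_Mapping.lookup w x = Poly_Mapping.lookup (a' + ?e + v) x"
      using key[of x, THEN conjunct1] by (simp add: lookup_add lookup_minus)
  qed
  moreover have "exp_size ?e \<le> t"
  proof -
    have "p * exp_size ?e \<le> exp_size e"
      unfolding exp_size_exp_scale[symmetric] using key by (intro exp_size_mono) (auto simp: lookup_minus)
    with *(3) have "p * exp_size ?e \<le> p * t" by linarith
    then show ?thesis using p by simp
  qed
  ultimately show "\<exists>a\<in>(\<lambda>a. Poly_Mapping.map (\<lambda>x. (x + (p - 1)) div p) (a - b)) ` A. \<exists>e v.
     w = a + e + v \<and> exp_size e \<le> t \<and> v \<in> digits ((p - 1) * t) p"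
    using *(1,4) a'_def by blast
qed

lemma sparse_gen_hits_digit_class:
  fixes F :: "'a::field mpoly"
  assumes p: "prime CHAR('a)" "p = CHAR('a)" and k: "s * ((2 ^ n + p * t) choose 2 ^ n) \<le> 2 ^ k"
    and "digit_class p t A F" "finite A" "card A \<le> s" "mvars F \<subseteq> {..<2 ^ n}" "F \<noteq> 0"
    and "\<And>m. m \<in> Poly_Mapping.keys F \<Longrightarrow> exp_size m \<le> D"
  shows "msubst F (sparse_gen n k) \<noteq> 0"
  using assms(4-)
proof (induction D arbitrary: A F)
  case 0
  then have "Poly_Mapping.keys F \<subseteq> {0}" by (auto simp: exp_size_eq_0_iff)
  from mpoly_expand_superset[OF _ this] have F: "F = mconst (Poly_Mapping.lookup F 0)" by simp
  then have "msubst F (sparse_gen n k) = F" by (metis msubst_mconst)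
  with 0 show ?case by simp
next
  case (Suc D)
  have p1: "p > 1" using p prime_gt_1_nat by blast
  from \<open>F \<noteq> 0\<close> obtain m where m: "m \<in> Poly_Mapping.keys F" by (metis ex_in_conv keys_eq_empty)
  let ?b = "exp_mod p m"
  show ?case
  proof (rule sparse_gen_hits_step[OF p])
    show "mvars F \<subseteq> {..<2 ^ n}" by fact
    have "card (exp_mod p ` Poly_Mapping.keys F) \<le> card A * ((2 ^ n + p * t) choose 2 ^ n)"
      using card_exp_mod_digit_class[OF Suc.prems(1,2,4)] p1 by simp
    also have "\<dots> \<le> s * ((2 ^ n + p * t) choose 2 ^ n)" using Suc.prems(3) by (rule mult_right_mono) simp
    finally show "card (exp_mod p ` Poly_Mapping.keys F) \<le> 2 ^ k" using k by linarith
    show "?b \<in> exp_mod p ` Poly_Mapping.keys F" using m by blast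
    show "msubst (residue_part p F ?b) (sparse_gen n k) \<noteq> 0"
    proof (rule Suc.IH)
      show "digit_class p t ((\<lambda>a. Poly_Mapping.map (\<lambda>x. (x + (p - 1)) div p) (a - ?b)) ` A) (residue_part p F ?b)"
        using Suc.prems(1) p1 by (intro digit_class_residue_part) auto
      show "card ((\<lambda>a. Poly_Mapping.map (\<lambda>x. (x + (p - 1)) div p) (a - ?b)) ` A) \<le> s"
        using card_image_le[OF Suc.prems(2)] Suc.prems(3) by (meson order_trans)
      show "residue_part p F ?b \<noteq> 0"
        using lookup_residue_part[OF m, of p] m by (auto simp: in_keys_iff)
      show "mvars (residue_part p F ?b) \<subseteq> {..<2 ^ n}"
        unfolding mvars_subset_iff
      proof
        fix w assume "w \<in> Poly_Mapping.keys (residue_part p F ?b)"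
        then obtain m' where m': "m' \<in> Poly_Mapping.keys F" "w = exp_div p m'" by (blast elim: keys_compE)
        then have "Poly_Mapping.keys w \<subseteq> Poly_Mapping.keys m'" by (auto simp: in_keys_iff intro!: Nat.gr0I)
        with m'(1) Suc.prems(4) show "Poly_Mapping.keys w \<subseteq> {..<2 ^ n}" unfolding mvars_subset_iff by blast
      qed
      show "exp_size w \<le> D" if w: "w \<in> Poly_Mapping.keys (residue_part p F ?b)" for w
      proof -
        obtain m' where m': "m' \<in> Poly_Mapping.keys F" "w = exp_div p m'" using w by (blast elim: keys_compE)
        have "p * exp_size w \<le> exp_size m'"
          unfolding exp_size_exp_scale[symmetric] m'(2) by (rule exp_size_mono) simp
        moreover have "2 * exp_size w \<le> p * exp_size w" using p1 by (intro mult_right_mono) auto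
        ultimately show ?thesis using Suc.prems(6)[OF m'(1)] by linarith
      qed
    qed (use Suc.prems(2) in auto)
  qed
qed

lemma sparse_gen_hits_char_p:
  fixes F :: "'a::field mpoly"
  assumes F: "sws_formula (2 ^ n) t s F" "F \<noteq> 0" and p: "prime CHAR('a)" "p = CHAR('a)"
    and k: "s * ((2 ^ n + p * t) choose 2 ^ n) \<le> 2 ^ k"
  shows "msubst F (sparse_gen n k) \<noteq> 0"
proof -
  from F(1) obtain a d Fs where
    Fs: "\<And>i. i < s \<Longrightarrow> tdeg (Fs i) \<le> t" and F_eq: "F = (\<Sum>i<s. mmonom (a i) * Fs i ^ d i)"
    unfolding sws_formula_def by blast
  show ?thesis
  proof (rule sparse_gen_hits_digit_class[OF p k])
    show "digit_class p t (a ` {..<s}) F"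
      unfolding digit_class_def
    proof
      fix m assume "m \<in> Poly_Mapping.keys F"
      then obtain i where i: "i \<in> {..<s}" "m \<in> Poly_Mapping.keys (mmonom (a i) * Fs i ^ d i)"
        unfolding F_eq by (rule keys_sumE)
      from i(2) obtain b v where "m = b + v" "b \<in> Poly_Mapping.keys (mmonom (a i) :: 'a mpoly)" "v \<in> Poly_Mapping.keys (Fs i ^ d i)"
        by (rule keys_multE)
      moreover have "Poly_Mapping.keys (Fs i ^ d i) \<subseteq> digits ((p - 1) * t) p"
        using Fs[of i] i(1) by (intro keys_power_digits[OF p]) (auto simp: tdeg_le_iff)
      ultimately have "m = a i + 0 + v" "exp_size 0 \<le> t" "v \<in> digits ((p - 1) * t) p" by auto
      then show "\<exists>a\<in>a ` {..<s}. \<exists>e v. m = a + e + v \<and> exp_size e \<le> t \<and> v \<in> digits ((p - 1) * t) p"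
        using i(1) by blast
    qed
    show "card (a ` {..<s}) \<le> s" using card_image_le[of "{..<s}" a] by simp
    show "mvars F \<subseteq> {..<2 ^ n}" using F(1) by (rule mvars_sws_formula)
    show "exp_size m \<le> tdeg F" if "m \<in> Poly_Mapping.keys F" for m
      using that tdeg_le_iff[of F "tdeg F"] by simp
  qed (use F(2) in auto)
qed

lemma binomial_le_power: "(N + D) choose N \<le> (N + 1) ^ D"
proof (induction D)
  case (Suc D)
  have "Suc D * ((N + Suc D) choose N) = Suc D * (Suc (N + D) choose Suc D)"
    by (metis add_Suc_right add_diff_cancel_left' binomial_symmetric le_add1)
  also have "\<dots> = Suc (N + D) * ((N + D) choose D)" by (rule Suc_times_binomial)
  also have "(N + D) choose D = (N + D) choose N"
    by (metis add_diff_cancel_left' binomial_symmetric le_add1)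
  also have "Suc (N + D) * ((N + D) choose N) \<le> (Suc D * (N + 1)) * (N + 1) ^ D"
    using Suc by (intro mult_mono) auto
  finally have "Suc D * ((N + Suc D) choose N) \<le> Suc D * (N + 1) ^ Suc D"
    by (simp only: power_Suc mult.assoc)
  then show ?case by (simp only: mult_le_cancel1 zero_less_Suc simp_thms)
qed simp

lemma succinct_sparse_gen:
  assumes "\<And>F :: 'a::field mpoly. sws_formula (2 ^ n) t s F \<Longrightarrow> F \<noteq> 0 \<Longrightarrow> msubst F (sparse_gen n k) \<noteq> 0"
  shows "succinct_generator n (k * (2 * n + 1)) (1 + (k + 1) * (3 * n + 3)) (sparse_gen n k :: nat \<Rightarrow> 'a mpoly)
    (sws_formula (2 ^ n) t s)"
  unfolding succinct_generator_def
proof (intro conjI allI impI)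
  show "\<exists>C. sps_multilinear n C \<and> sps_size n C \<le> 1 + (k + 1) * (3 * n + 3) \<and>
      sps_poly n C = (\<Sum>S\<in>Pow {..<n}. mconst (meval (sparse_gen n k (set_code S)) \<alpha>) * mono_x S)" for \<alpha> :: "nat \<Rightarrow> 'a"
    by (rule sparse_gen_formula)
  show "F \<noteq> 0 \<longleftrightarrow> msubst F (sparse_gen n k) \<noteq> 0" if "sws_formula (2 ^ n) t s F" for F :: "'a mpoly"
    using assms[OF that] by auto
qed (rule mvars_sparse_gen)

lemma ex_sparse_gen_hits:
  fixes t :: nat
  shows "\<exists>c e. \<forall>n k s. k \<ge> 1 \<longrightarrow> s < 2 ^ k \<longrightarrow> (\<forall>F :: 'a::field mpoly. sws_formula (2 ^ n) t s F \<longrightarrow> F \<noteq> 0 \<longrightarrow>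
    msubst F (sparse_gen n (k * c + (n + 1) * e)) \<noteq> 0)"
proof (cases "CHAR('a) = 0")
  case True
  then show ?thesis
    by (intro exI[of _ "2 ^ (t + 3)"] exI[of _ 0] allI impI) (simp only: mult_0_right add_0_right sparse_gen_hits_char_0 not_False_eq_True)
next
  case False
  define p where "p = CHAR('a)"
  have p: "prime CHAR('a)" using False by (intro prime_CHAR_semidom) simp
  have "s * ((2 ^ n + p * t) choose 2 ^ n) \<le> 2 ^ (k * 1 + (n + 1) * (p * t))" if "s < 2 ^ k" for n k s :: nat
  proof -
    have "(2 ^ n + p * t) choose 2 ^ n \<le> (2 ^ n + 1) ^ (p * t)" by (rule binomial_le_power)
    also have "\<dots> \<le> (2 ^ (n + 1)) ^ (p * t)" by (intro power_mono) auto
    finally have "s * ((2 ^ n + p * t) choose 2 ^ n) \<le> 2 ^ k * (2 ^ (n + 1)) ^ (p * t)"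
      using that by (intro mult_mono) auto
    then show ?thesis by (simp only: power_add power_mult mult_1_right)
  qed
  then show ?thesis using sparse_gen_hits_char_p[OF _ _ p p_def] by blast
qed

theorem theorem5p13:
  fixes t :: nat
  assumes "t \<ge> 1"
  shows "\<exists>p :: real poly poly. \<forall>n s :: nat. n \<ge> 1 \<longrightarrow> s \<ge> 1 \<longrightarrow>
           (\<exists>(m :: nat) (s' :: nat) (G :: nat \<Rightarrow> 'a::field mpoly).
              real s' \<le> poly (poly p [:log 2 (real s):]) (real n) \<and>
              succinct_generator n m s' G (sws_formula (2 ^ n) t s))"
proof -
  obtain c e :: nat where hits: "\<And>n k s F. k \<ge> 1 \<Longrightarrow> s < 2 ^ k \<Longrightarrow> sws_formula (2 ^ n) t s F \<Longrightarrow> (F :: 'a mpoly) \<noteq> 0 \<Longrightarrow>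
      msubst F (sparse_gen n (k * c + (n + 1) * e)) \<noteq> 0"
    using ex_sparse_gen_hits[of t, where 'a = 'a] by blast
  define p :: "real poly poly" where
    "p = [: 1 + [: real c + real e + 1, real e :] * [: 3, 3 :], [: real c :] * [: 3, 3 :] :]"
  show ?thesis
  proof (intro exI[of _ p] allI impI)
    fix n s :: nat assume "n \<ge> 1" "s \<ge> 1"
    define k where "k = nat \<lfloor>log 2 (real s)\<rfloor> + 1"
    have L: "log 2 (real s) \<ge> 0" using \<open>s \<ge> 1\<close> by simp
    have k: "k \<ge> 1" "real k \<le> log 2 (real s) + 1" "log 2 (real s) < real k"
      using L by (simp_all add: k_def) linarith
    have "real s = 2 powr log 2 (real s)" using \<open>s \<ge> 1\<close> by simp
    also have "\<dots> < 2 powr real k" using k(3) by simp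
    finally have "real s < real (2 ^ k)" by (simp add: powr_realpow)
    then have s: "s < 2 ^ k" by (simp only: of_nat_less_iff)
    let ?K = "k * c + (n + 1) * e"
    have "real (1 + (?K + 1) * (3 * n + 3)) = 1 + (real k * real c + (real n + 1) * real e + 1) * (3 * real n + 3)"
      by (simp add: algebra_simps)
    also have "\<dots> \<le> 1 + ((log 2 (real s) + 1) * real c + (real n + 1) * real e + 1) * (3 * real n + 3)"
      using k(2) by (intro add_left_mono mult_right_mono add_right_mono) auto
    also have "\<dots> = poly (poly p [:log 2 (real s):]) (real n)"
      by (simp add: p_def algebra_simps)
    finally have "real (1 + (?K + 1) * (3 * n + 3)) \<le> poly (poly p [:log 2 (real s):]) (real n)" .
    moreover have "succinct_generator n (?K * (2 * n + 1)) (1 + (?K + 1) * (3 * n + 3)) (sparse_gen n ?K :: nat \<Rightarrow> 'a mpoly)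
        (sws_formula (2 ^ n) t s)"
      by (rule succinct_sparse_gen) (rule hits[OF k(1) s])
    ultimately show "\<exists>(m :: nat) (s' :: nat) (G :: nat \<Rightarrow> 'a mpoly).
        real s' \<le> poly (poly p [:log 2 (real s):]) (real n) \<and>
        succinct_generator n m s' G (sws_formula (2 ^ n) t s)"
      by blast
  qed
qed

end
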